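(* Let $n\ge1$. Then $T_n'^a(\iota_n(x))=T_n'^f(x)\in R^f$ for all $x\in\mathrm{TL}_n(R^f)$.
   Context: Rings. $R_0^f=\mathbb{Z}[z]\subset R^f=\mathbb{Z}[A^{\pm1}]$ via $z=-A^2-A^{-2}$; $R_0^a=\mathbb{Z}[z_0,z_1,z_2,\dots]\subset R^a=\mathbb{Z}[A^{\pm1},z_1,z_2,\dots]$ via $z_0=-A^2-A^{-2}$; $R^f$ is a subring of $R^a$. Let $V_n=\{0,1\}\times\{1,\dots,n\}$, ordered by $(0,1)<(0,2)<\cdots<(0,n)<(1,n)<\cdots<(1,2)<(1,1)$. A flat virtual $n$-tangle is a partition of $V_n$ into pairs; $\mathcal{E}_n$ is the set of these. Virtual Temperley--Lieb algebra. $\mathrm{VTL}_n(R^f)$ is the free $R^f$-module with basis $\mathcal{E}_n$ and bilinear multiplication: for $E,E'\in\mathcal{E}_n$, view pairs as arcs and glue the point $(1,i)$ of $E$ to the point $(0,i)$ of $E'$ for each $i$; the result consists of $n$ arcs with endpoints the points $(0,i)$ of $E$ and $(1,i)$ of $E'$, determining $E*E'\in\mathcal{E}_n$, and $m$ closed curves; $E\,E'=z^m(E*E')$. $T_n'^f:\mathrm{VTL}_n(R^f)\to R^f$ is the $R^f$-linear map with $T_n'^f(E)=z^{t_n(E)}$ for $E\in\mathcal{E}_n$, where $t_n(E)$ is the number of closed curves obtained from the arcs of $E$ by joining $(0,i)$ to $(1,i)$ by an additional arc for every $i$. Temperley--Lieb algebra. $\mathrm{TL}_n(R^f)=R^f\otimes\mathrm{TL}_n$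 is the $R^f$-algebra presented by generators $E_1,\dots,E_{n-1}$ and relations $E_i^2=zE_i$, $E_iE_j=E_jE_i$ for $|i-j|\ge2$, $E_iE_jE_i=E_i$ for $|i-j|=1$ (for $n=1$ it is $R^f$). It embeds in $\mathrm{VTL}_n(R^f)$ by sending $E_i$ to the flat virtual tangle $\{\{(0,i),(0,i+1)\},\{(1,i),(1,i+1)\}\}\cup\{\{(0,k),(1,k)\}\mid k\ne i,i+1\}$ (Kauffman), and is viewed as a subalgebra of $\mathrm{VTL}_n(R^f)$; this is the meaning of $T_n'^f(x)$ for $x\in\mathrm{TL}_n(R^f)$. Arrow Temperley--Lieb algebra. An arrow flat $n$-tangle is a pair $F=(E,f)$ with $E\in\mathcal{E}_n$ and $f:E\to\mathbb{Z}$ such that, for $\alpha=\{(a,b),(c,d)\}\in E$, $f(\alpha)$ is odd if $a=c$ and even if $a\ne c$. $\mathcal{F}_n$ is the set of these and $\mathrm{ATL}_n(R^a)$ is the free $R^a$-module with basis $\mathcal{F}_n$, with the following multiplication. For $E,E'\in\mathcal{E}_n$, an arc of length $\ell$ in $E\sqcup E'$ is an $\ell$-tuple $\hat\alpha=(\alpha_1,\dots,\alpha_\ell)$ of elements of $E\sqcup E'$, $\alpha_i=\{(a_i,b_{i-1}),(c_i,b_i)\}$, such that: (a) if $\alpha_i\in E$ and $i<\ell$, then $c_i=1$, $\alpha_{i+1}\in E'$ and $a_{i+1}=0$; (b) if $\alpha_i\in E'$ and $i<\ell$, then $c_i=0$, $\alpha_{i+1}\in E$ and $a_{i+1}=1$;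 (c) $a_1=0$ if $\alpha_1\in E$, $a_1=1$ if $\alpha_1\in E'$, $c_\ell=0$ if $\alpha_\ell\in E$, $c_\ell=1$ if $\alpha_\ell\in E'$, and $(a_1,b_0)<(c_\ell,b_\ell)$. Its boundary is $\partial\hat\alpha=\{(a_1,b_0),(c_\ell,b_\ell)\}$; the boundaries of the $n$ arcs form $E*E'$. A cycle of length $2p\ge2$ in $E\sqcup E'$ is a $2p$-tuple $\hat\gamma=(\gamma_1,\dots,\gamma_{2p})$, $\gamma_i=\{(a_i,b_{i-1}),(c_i,b_i)\}$, such that $\gamma_i\in E$ and $a_i=c_i=1$ for $i$ odd, $\gamma_i\in E'$ and $a_i=c_i=0$ for $i$ even, and $b_0=b_{2p}<b_i$ for $1\le i\le 2p-1$. The parity of $\alpha=\{(a,b),(c,d)\}$ is $\varpi(\alpha)=-1$ if $a=c$ and $1$ if $a\ne c$. For an arc or cycle $(\alpha_1,\dots,\alpha_\ell)$ with $\alpha_i=\{(a_i,b_{i-1}),(c_i,b_i)\}$ (also for the cycles in a closure, defined below), the cumulated parity is $\varpi^c(\alpha_i)=\prod_{j=1}^{i-1}\varpi(\alpha_j)$ if $(a_i,b_{i-1})<(c_i,b_i)$, and $\varpi^c(\alpha_i)=\prod_{j=1}^{i}\varpi(\alpha_j)$ if $(c_i,b_i)<(a_i,b_{i-1})$. For $F=(E,f)$, $F'=(E',f')\in\mathcal{F}_n$ let $f^*$ equal $f$ on $E$ and $f'$ on $E'$. Put $g(\partial\hat\alpha)=\sum_{i}\varpi^c(\alpha_i)f^*(\alpha_i)$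 for each arc, and $F*F'=(E*E',g)$; for each cycle put $h(\hat\gamma)=\sum_i\varpi^c(\gamma_i)f^*(\gamma_i)$ (even) and $\zeta(\hat\gamma)=|h(\hat\gamma)|/2$. If $\hat\gamma_1,\dots,\hat\gamma_m$ are the cycles of $E\sqcup E'$, then $F\,F'=z_{\zeta(\hat\gamma_1)}\cdots z_{\zeta(\hat\gamma_m)}(F*F')$. This is an associative unital algebra. For $1\le i\le n-1$, $F_i\in\mathcal{F}_n$ has pairs $\{(0,i),(0,i+1)\}$ and $\{(1,i),(1,i+1)\}$ both labeled $1$, and $\{(0,k),(1,k)\}$ labeled $0$ for $k\ne i,i+1$. $\iota_n:\mathrm{TL}_n(R^f)\to\mathrm{ATL}_n(R^a)$ is the (injective) $R^f$-algebra homomorphism which sends $E_i$ to $F_i$ for all $i$. Trace. For $E\in\mathcal{E}_n$, a cycle of length $\ell$ in the closure $\hat E$ is an $\ell$-tuple $\hat\gamma=(\gamma_1,\dots,\gamma_\ell)$ in $E$, $\gamma_i=\{(a_i,b_{i-1}),(c_i,b_i)\}$, such that $a_{i+1}=1$ if $c_i=0$ and $a_{i+1}=0$ if $c_i=1$, for $1\le i\le\ell-1$; and $b_0=b_\ell<b_i$ for $1\le i\le\ell-1$, $a_1=0$, $c_\ell=1$. For $F=(E,f)\in\mathcal{F}_n$ put $h(\hat\gamma)=\sum_{i=1}^\ell\varpi^c(\gamma_i)f(\gamma_i)$ (even) and $\zeta(\hat\gamma)=|h(\hat\gamma)|/2$. If $\hat\gamma_1,\dots,\hat\gamma_m$ are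 the cycles of $\hat E$, $T_n'^a(F)=z_{\zeta(\hat\gamma_1)}\cdots z_{\zeta(\hat\gamma_m)}$, extended $R^a$-linearly to $T_n'^a:\mathrm{ATL}_n(R^a)\to R^a$. *)

theory Defs
  imports
    "HOL-Library.Poly_Mapping"
    "HOL-Library.Disjoint_Sets"
    "HOL-Algebra.QuotRing"
begin

text \<open>
  \<open>Rf\<close> is the group ring of the integers, i.e. the ring of Laurent polynomials in \<open>A\<close>, where
  \<open>A^k\<close> is \<open>Poly_Mapping.single k 1\<close>.  \<open>Ra\<close> is the polynomial ring over \<open>Rf\<close> in
  countably many variables; variable number \<open>k\<close> is \<open>z\<^bsub>k+1\<^esub>\<close>, since \<open>z\<^sub>0\<close> is not a variable.
\<close>

type_synonym Rf = "int \<Rightarrow>\<^sub>0 int"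
type_synonym Ra = "(nat \<Rightarrow>\<^sub>0 nat) \<Rightarrow>\<^sub>0 Rf"

definition zf :: Rf where
  "zf = - Poly_Mapping.single 2 1 - Poly_Mapping.single (- 2) 1"

definition Rf_to_Ra :: "Rf \<Rightarrow> Ra" where
  "Rf_to_Ra c = Poly_Mapping.single 0 c"

fun za :: "nat \<Rightarrow> Ra" where
  "za 0 = Rf_to_Ra zf"
| "za (Suc k) = Poly_Mapping.single (Poly_Mapping.single k 1) 1"

definition scale :: "'r::comm_ring_1 \<Rightarrow> ('k \<Rightarrow>\<^sub>0 'r) \<Rightarrow> ('k \<Rightarrow>\<^sub>0 'r)" where
  "scale c x = Poly_Mapping.map ((*) c) x"

text \<open>The algebra which is free as a module on \<open>B\<close>, with the product of basis elements given by
  \<open>m\<close> and with unit the basis element \<open>e\<close>.\<close>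

definition basis_algebra ::
  "'k set \<Rightarrow> ('k \<Rightarrow> 'k \<Rightarrow> ('k \<Rightarrow>\<^sub>0 'r::comm_ring_1)) \<Rightarrow> 'k \<Rightarrow> ('k \<Rightarrow>\<^sub>0 'r) ring" where
  "basis_algebra B m e =
    \<lparr>carrier = {x. Poly_Mapping.keys x \<subseteq> B},
     mult = (\<lambda>x y. \<Sum>a\<in>Poly_Mapping.keys x. \<Sum>b\<in>Poly_Mapping.keys y.
               scale (Poly_Mapping.lookup x a * Poly_Mapping.lookup y b) (m a b)),
     one = Poly_Mapping.single e 1,
     zero = 0,
     add = (+)\<rparr>"

type_synonym pt = "nat \<times> nat"
type_synonym tangle = "pt set set"

definition pts :: "nat \<Rightarrow> pt set" where
  "pts n = {0, 1} \<times> {1..n}"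

definition pt_less :: "pt \<Rightarrow> pt \<Rightarrow> bool" where
  "pt_less p q \<longleftrightarrow>
    fst p < fst q \<or> (fst p = fst q \<and> (if fst p = 0 then snd p < snd q else snd q < snd p))"

definition tangles :: "nat \<Rightarrow> tangle set" where
  "tangles n = {E. partition_on (pts n) E \<and> (\<forall>\<alpha>\<in>E. card \<alpha> = 2)}"

definition id_tangle :: "nat \<Rightarrow> tangle" where
  "id_tangle n = {{(0, k), (1, k)} | k. k \<in> {1..n}}"

definition gen_tangle :: "nat \<Rightarrow> nat \<Rightarrow> tangle" where
  "gen_tangle n i =
    {{(0, i), (0, i + 1)}, {(1, i), (1, i + 1)}} \<union>
    {{(0, k), (1, k)} | k. k \<in> {1..n} \<and> k \<noteq> i \<and> k \<noteq> i + 1}"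

text \<open>In \<open>E \<squnion> E'\<close>, elements and points of \<open>E\<close> are tagged \<open>Lft\<close>, those of \<open>E'\<close> are tagged
  \<open>Rgt\<close>.\<close>

datatype side = Lft | Rgt

text \<open>Adjacency in the 1-complex obtained by gluing \<open>(1,i)\<close> of \<open>E\<close> to \<open>(0,i)\<close> of \<open>E'\<close>.  Its
  connected components are the classes of the reflexive transitive closure: the closed curves are
  the components without free end, the arcs are the others.\<close>

definition glue_adj :: "nat \<Rightarrow> tangle \<Rightarrow> tangle \<Rightarrow> (side \<times> pt) rel" where
  "glue_adj n E E' =
    {((Lft, p), (Lft, q)) | p q. {p, q} \<in> E} \<union>
    {((Rgt, p), (Rgt, q)) | p q. {p, q} \<in> E'} \<union>
    {((Lft, (1, i)), (Rgt, (0, i))) | i. i \<in> {1..n}} \<union>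
    {((Rgt, (0, i)), (Lft, (1, i))) | i. i \<in> {1..n}}"

definition free_end :: "pt \<Rightarrow> side \<times> pt" where
  "free_end p = (if fst p = 0 then (Lft, p) else (Rgt, p))"

definition tangle_star :: "nat \<Rightarrow> tangle \<Rightarrow> tangle \<Rightarrow> tangle" where
  "tangle_star n E E' =
    {{p, q} | p q. p \<in> pts n \<and> q \<in> pts n \<and> p \<noteq> q \<and>
       (free_end p, free_end q) \<in> (glue_adj n E E')\<^sup>*}"

definition glue_loops :: "nat \<Rightarrow> tangle \<Rightarrow> tangle \<Rightarrow> nat" where
  "glue_loops n E E' =
    card {C \<in> (UNIV \<times> pts n) // (glue_adj n E E')\<^sup>*. C \<inter> free_end ` pts n = {}}"

definition closure_adj :: "nat \<Rightarrow> tangle \<Rightarrow> pt rel" where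
  "closure_adj n E =
    {(p, q). {p, q} \<in> E} \<union>
    {((0, i), (1, i)) | i. i \<in> {1..n}} \<union> {((1, i), (0, i)) | i. i \<in> {1..n}}"

definition closure_loops :: "nat \<Rightarrow> tangle \<Rightarrow> nat" where
  "closure_loops n E = card (pts n // (closure_adj n E)\<^sup>*)"

definition VTL :: "nat \<Rightarrow> (tangle \<Rightarrow>\<^sub>0 Rf) ring" where
  "VTL n = basis_algebra (tangles n)
    (\<lambda>E E'. Poly_Mapping.single (tangle_star n E E') (zf ^ glue_loops n E E'))
    (id_tangle n)"

definition trace_f :: "nat \<Rightarrow> (tangle \<Rightarrow>\<^sub>0 Rf) \<Rightarrow> Rf" where
  "trace_f n x = (\<Sum>E\<in>Poly_Mapping.keys x. Poly_Mapping.lookup x E * zf ^ closure_loops n E)"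

text \<open>
  A tuple with entries \<open>\<alpha>\<^sub>i = {(a\<^sub>i, b\<^bsub>i-1\<^esub>), (c\<^sub>i, b\<^sub>i)}\<close> is the list of the triples
  \<open>(s\<^sub>i, (a\<^sub>i, b\<^bsub>i-1\<^esub>), (c\<^sub>i, b\<^sub>i))\<close>, where \<open>s\<^sub>i\<close> tells whether \<open>\<alpha>\<^sub>i\<close> lies in \<open>E\<close> or in \<open>E'\<close>;
  list positions start at 0.  The conditions on arcs and cycles determine the points
  \<open>(a\<^sub>i, b\<^bsub>i-1\<^esub>)\<close> and \<open>(c\<^sub>i, b\<^sub>i)\<close> from the tuple \<open>(\<alpha>\<^sub>1, \<dots>, \<alpha>\<^sub>l)\<close>, so lists and tuples
  correspond bijectively.  For tuples in a single \<open>E\<close> the tag is the unit element.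
\<close>

type_synonym 's walk = "('s \<times> pt \<times> pt) list"

abbreviation tag :: "'s walk \<Rightarrow> nat \<Rightarrow> 's" where
  "tag w i \<equiv> fst (w ! i)"

abbreviation src :: "'s walk \<Rightarrow> nat \<Rightarrow> pt" where
  "src w i \<equiv> fst (snd (w ! i))"

abbreviation tgt :: "'s walk \<Rightarrow> nat \<Rightarrow> pt" where
  "tgt w i \<equiv> snd (snd (w ! i))"

abbreviation edge :: "'s walk \<Rightarrow> nat \<Rightarrow> pt set" where
  "edge w i \<equiv> {src w i, tgt w i}"

definition is_arc :: "tangle \<Rightarrow> tangle \<Rightarrow> side walk \<Rightarrow> bool" where
  "is_arc E E' w \<longleftrightarrow>
    w \<noteq> [] \<and>
    (\<forall>i<length w. edge w i \<in> (case tag w i of Lft \<Rightarrow> E | Rgt \<Rightarrow> E')) \<and>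
    (\<forall>i. Suc i < length w \<longrightarrow>
      snd (src w (Suc i)) = snd (tgt w i) \<and>
      (tag w i = Lft \<longrightarrow>
        fst (tgt w i) = 1 \<and> tag w (Suc i) = Rgt \<and> fst (src w (Suc i)) = 0) \<and>
      (tag w i = Rgt \<longrightarrow>
        fst (tgt w i) = 0 \<and> tag w (Suc i) = Lft \<and> fst (src w (Suc i)) = 1)) \<and>
    fst (src w 0) = (case tag w 0 of Lft \<Rightarrow> 0 | Rgt \<Rightarrow> 1) \<and>
    fst (tgt w (length w - 1)) = (case tag w (length w - 1) of Lft \<Rightarrow> 0 | Rgt \<Rightarrow> 1) \<and>
    pt_less (src w 0) (tgt w (length w - 1))"

definition boundary :: "'s walk \<Rightarrow> pt set" where
  "boundary w = {src w 0, tgt w (length w - 1)}"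

definition is_cycle :: "tangle \<Rightarrow> tangle \<Rightarrow> side walk \<Rightarrow> bool" where
  "is_cycle E E' w \<longleftrightarrow>
    w \<noteq> [] \<and> even (length w) \<and>
    (\<forall>i<length w.
      if even i then tag w i = Lft \<and> edge w i \<in> E \<and> fst (src w i) = 1 \<and> fst (tgt w i) = 1
      else tag w i = Rgt \<and> edge w i \<in> E' \<and> fst (src w i) = 0 \<and> fst (tgt w i) = 0) \<and>
    (\<forall>i. Suc i < length w \<longrightarrow>
      snd (src w (Suc i)) = snd (tgt w i) \<and> snd (src w 0) < snd (tgt w i)) \<and>
    snd (src w 0) = snd (tgt w (length w - 1))"

definition is_closure_cycle :: "tangle \<Rightarrow> unit walk \<Rightarrow> bool" where
  "is_closure_cycle E w \<longleftrightarrow>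
    w \<noteq> [] \<and>
    (\<forall>i<length w. edge w i \<in> E) \<and>
    (\<forall>i. Suc i < length w \<longrightarrow>
      snd (src w (Suc i)) = snd (tgt w i) \<and>
      (fst (tgt w i) = 0 \<longrightarrow> fst (src w (Suc i)) = 1) \<and>
      (fst (tgt w i) = 1 \<longrightarrow> fst (src w (Suc i)) = 0) \<and>
      snd (src w 0) < snd (tgt w i)) \<and>
    snd (src w 0) = snd (tgt w (length w - 1)) \<and>
    fst (src w 0) = 0 \<and> fst (tgt w (length w - 1)) = 1"

definition parity :: "pt set \<Rightarrow> int" where
  "parity \<alpha> = (if \<exists>a b d. \<alpha> = {(a, b), (a, d)} then - 1 else 1)"

definition cumulated_parity :: "'s walk \<Rightarrow> nat \<Rightarrow> int" where
  "cumulated_parity w i =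
    (if pt_less (src w i) (tgt w i) then \<Prod>j<i. parity (edge w j)
     else \<Prod>j\<le>i. parity (edge w j))"

definition label_sum :: "('s \<Rightarrow> pt set \<Rightarrow> int) \<Rightarrow> 's walk \<Rightarrow> int" where
  "label_sum f w = (\<Sum>i<length w. cumulated_parity w i * f (tag w i) (edge w i))"

definition zeta :: "('s \<Rightarrow> pt set \<Rightarrow> int) \<Rightarrow> 's walk \<Rightarrow> nat" where
  "zeta f w = nat \<bar>label_sum f w\<bar> div 2"

type_synonym arrow_tangle = "tangle \<times> (pt set \<Rightarrow> int)"

definition arrow_tangles :: "nat \<Rightarrow> arrow_tangle set" where
  "arrow_tangles n =
    {(E, f). E \<in> tangles n \<and> f \<in> E \<rightarrow>\<^sub>E UNIV \<and>
       (\<forall>a b c d. {(a, b), (c, d)} \<in> E \<longrightarrow> (odd (f {(a, b), (c, d)}) \<longleftrightarrow> a = c))}"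

definition id_arrow_tangle :: "nat \<Rightarrow> arrow_tangle" where
  "id_arrow_tangle n = (id_tangle n, \<lambda>\<alpha>\<in>id_tangle n. 0)"

definition gen_arrow_tangle :: "nat \<Rightarrow> nat \<Rightarrow> arrow_tangle" where
  "gen_arrow_tangle n i =
    (gen_tangle n i,
     \<lambda>\<alpha>\<in>gen_tangle n i. if \<alpha> \<in> {{(0, i), (0, i + 1)}, {(1, i), (1, i + 1)}} then 1 else 0)"

definition join_labels ::
  "(pt set \<Rightarrow> int) \<Rightarrow> (pt set \<Rightarrow> int) \<Rightarrow> side \<Rightarrow> pt set \<Rightarrow> int" where
  "join_labels f f' s = (case s of Lft \<Rightarrow> f | Rgt \<Rightarrow> f')"

definition arrow_star :: "nat \<Rightarrow> arrow_tangle \<Rightarrow> arrow_tangle \<Rightarrow> arrow_tangle" where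
  "arrow_star n = (\<lambda>(E, f) (E', f').
    (tangle_star n E E',
     \<lambda>\<beta>\<in>tangle_star n E E'.
       THE k. \<exists>w. is_arc E E' w \<and> boundary w = \<beta> \<and> k = label_sum (join_labels f f') w))"

definition arrow_coeff :: "arrow_tangle \<Rightarrow> arrow_tangle \<Rightarrow> Ra" where
  "arrow_coeff = (\<lambda>(E, f) (E', f').
    \<Prod>w\<in>{w. is_cycle E E' w}. za (zeta (join_labels f f') w))"

definition ATL :: "nat \<Rightarrow> (arrow_tangle \<Rightarrow>\<^sub>0 Ra) ring" where
  "ATL n = basis_algebra (arrow_tangles n)
    (\<lambda>F F'. Poly_Mapping.single (arrow_star n F F') (arrow_coeff F F'))
    (id_arrow_tangle n)"

definition arrow_closure_coeff :: "arrow_tangle \<Rightarrow> Ra" where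
  "arrow_closure_coeff = (\<lambda>(E, f).
    \<Prod>w\<in>{w. is_closure_cycle E w}. za (zeta (\<lambda>_. f) w))"

definition trace_a :: "nat \<Rightarrow> (arrow_tangle \<Rightarrow>\<^sub>0 Ra) \<Rightarrow> Ra" where
  "trace_a n x =
    (\<Sum>F\<in>Poly_Mapping.keys x. Poly_Mapping.lookup x F * arrow_closure_coeff F)"

text \<open>The free algebra has as basis the words in the letters \<open>1, \<dots>, n - 1\<close>, the letter \<open>i\<close>
  standing for \<open>E\<^sub>i\<close>.\<close>

definition free_algebra :: "nat \<Rightarrow> (nat list \<Rightarrow>\<^sub>0 Rf) ring" where
  "free_algebra n = basis_algebra (lists {1..<n}) (\<lambda>u v. Poly_Mapping.single (u @ v) 1) []"

definition TL_relators :: "nat \<Rightarrow> (nat list \<Rightarrow>\<^sub>0 Rf) set" where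
  "TL_relators n =
    {Poly_Mapping.single [i, i] 1 - Poly_Mapping.single [i] zf | i. i \<in> {1..<n}} \<union>
    {Poly_Mapping.single [i, j] 1 - Poly_Mapping.single [j, i] 1 | i j.
       i \<in> {1..<n} \<and> j \<in> {1..<n} \<and> \<bar>int i - int j\<bar> \<ge> 2} \<union>
    {Poly_Mapping.single [i, j, i] 1 - Poly_Mapping.single [i] 1 | i j.
       i \<in> {1..<n} \<and> j \<in> {1..<n} \<and> \<bar>int i - int j\<bar> = 1}"

definition TL :: "nat \<Rightarrow> (nat list \<Rightarrow>\<^sub>0 Rf) set ring" where
  "TL n = free_algebra n Quot (genideal (free_algebra n) (TL_relators n))"

text \<open>\<open>eval_poly \<phi> A g\<close> is the algebra homomorphism from the free algebra to \<open>A\<close> that sends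
  the letter \<open>i\<close> to \<open>g i\<close>, where scalars act on \<open>A\<close> through \<open>\<phi>\<close>; \<open>TL_hom \<phi> A g\<close> is the
  homomorphism induced by it on the quotient.\<close>

definition eval_poly ::
  "(Rf \<Rightarrow> 'r::comm_ring_1) \<Rightarrow> ('k \<Rightarrow>\<^sub>0 'r) ring \<Rightarrow> (nat \<Rightarrow> ('k \<Rightarrow>\<^sub>0 'r)) \<Rightarrow>
    (nat list \<Rightarrow>\<^sub>0 Rf) \<Rightarrow> ('k \<Rightarrow>\<^sub>0 'r)" where
  "eval_poly \<phi> A g p =
    (\<Sum>u\<in>Poly_Mapping.keys p.
      scale (\<phi> (Poly_Mapping.lookup p u)) (foldr (\<lambda>i y. g i \<otimes>\<^bsub>A\<^esub> y) u \<one>\<^bsub>A\<^esub>))"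

definition TL_hom ::
  "(Rf \<Rightarrow> 'r::comm_ring_1) \<Rightarrow> ('k \<Rightarrow>\<^sub>0 'r) ring \<Rightarrow> (nat \<Rightarrow> ('k \<Rightarrow>\<^sub>0 'r)) \<Rightarrow>
    (nat list \<Rightarrow>\<^sub>0 Rf) set \<Rightarrow> ('k \<Rightarrow>\<^sub>0 'r)" where
  "TL_hom \<phi> A g X = the_elem (eval_poly \<phi> A g ` X)"

definition TL_to_VTL :: "nat \<Rightarrow> (nat list \<Rightarrow>\<^sub>0 Rf) set \<Rightarrow> (tangle \<Rightarrow>\<^sub>0 Rf)" where
  "TL_to_VTL n = TL_hom (\<lambda>c. c) (VTL n) (\<lambda>i. Poly_Mapping.single (gen_tangle n i) 1)"

definition iota :: "nat \<Rightarrow> (nat list \<Rightarrow>\<^sub>0 Rf) set \<Rightarrow> (arrow_tangle \<Rightarrow>\<^sub>0 Ra)" where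
  "iota n = TL_hom Rf_to_Ra (ATL n) (\<lambda>i. Poly_Mapping.single (gen_arrow_tangle n i) 1)"

end

theory Submission
  imports Defs Complex_Main "HOL-Combinatorics.Transposition"
begin

text \<open>
  Label the arc from \<open>p = (a,b)\<close> to \<open>q = (c,d)\<close>, \<open>p < q\<close>, of any flat tangle by
  \<open>(-1)\<^sup>a (d - b)\<close>.  With these labels the summand of an arc in a label sum, cumulated parity
  included, is a sign that is constant along the walk times the horizontal displacement of the arc.
  So label sums telescope: they are canonical labels again for arcs of a product, and vanish for
  cycles.  Hence labelling canonically commutes with products and traces; the parity condition on
  labels, which may fail for tangles outside the Temperley--Lieb algebra, plays no role.  Since
  \<open>E\<^sub>i\<close> is sent to \<open>F\<^sub>i\<close>, the restriction to the Temperley--Lieb algebra is \<open>\<iota>\<close>.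

  Arcs and closed curves, in products and in closures, are orbits of the composition of two
  involutions: one exchanges the ends of every arc, the other the two points at every joint.

  Left multiplication by \<open>E\<^sub>i\<close> conjugates the involution of a tangle by a transposition.  Since these
  operators satisfy the Temperley--Lieb relations, the relators lie in the annihilator ideal of the
  virtual algebra, and the maps from the quotient are well defined without associativity of the
  target algebras.
\<close>

section \<open>Linear extension and monoid algebras\<close>

definition linext :: "('k \<Rightarrow> 'a::zero \<Rightarrow> 'b::comm_monoid_add) \<Rightarrow> ('k \<Rightarrow>\<^sub>0 'a) \<Rightarrow> 'b" where
  "linext f x = (\<Sum>k\<in>Poly_Mapping.keys x. f k (Poly_Mapping.lookup x k))"

lemma linext_single: "additive (f k) \<Longrightarrow> linext f (Poly_Mapping.single k c) = f k c"
  by (cases "c = 0") (simp_all add: linext_def additive.zero)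

lemma additive_compose: "additive f \<Longrightarrow> additive g \<Longrightarrow> additive (\<lambda>x. f (g x))"
  by (simp add: additive_def)

lemma additive_single: "additive (Poly_Mapping.single k)"
  by (simp add: additive_def single_add)

lemma additive_mult_left: "additive (\<lambda>c. (d::'a::ring) * c)"
  and additive_mult_right: "additive (\<lambda>c. c * (d::'a::ring))"
  by (simp_all add: additive_def algebra_simps)

lemma additive_linext:
  assumes "\<And>k. additive (f k)"
  shows "additive (linext f)"
  unfolding additive_def linext_def
  by (intro allI setsum_keys_plus_distrib) (use assms in \<open>auto simp: additive.zero additive.add\<close>)

lemma additive_linext_param:
  assumes "\<And>k c. additive (\<lambda>d. f d k c)"
  shows "additive (\<lambda>d. linext (f d) x)"
  using assms unfolding additive_def linext_def by (simp add: sum.distrib)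

lemma linext_single_id: "linext Poly_Mapping.single x = x"
  unfolding linext_def
  by (rule poly_mapping_eqI) (simp add: lookup_sum lookup_single when_def sum.delta in_keys_iff)

lemma additive_eqI:
  fixes F G :: "('k \<Rightarrow>\<^sub>0 'a::ab_group_add) \<Rightarrow> 'b::ab_group_add"
  assumes "additive F" "additive G" "Poly_Mapping.keys x \<subseteq> K"
    and single_eq: "\<And>k c. k \<in> K \<Longrightarrow> F (Poly_Mapping.single k c) = G (Poly_Mapping.single k c)"
  shows "F x = G x"
proof -
  have expand: "H x = linext (\<lambda>k c. H (Poly_Mapping.single k c)) x"
    if "additive H" for H :: "('k \<Rightarrow>\<^sub>0 'a) \<Rightarrow> 'b"
    using additive.sum[OF that] linext_single_id[of x] unfolding linext_def by metis
  show ?thesis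
    unfolding expand[OF assms(1)] expand[OF assms(2)] linext_def
    using assms(3) single_eq by (intro sum.cong) auto
qed

lemma keys_linext_subset:
  assumes "\<And>k. k \<in> Poly_Mapping.keys x \<Longrightarrow> Poly_Mapping.keys (f k (Poly_Mapping.lookup x k)) \<subseteq> K"
  shows "Poly_Mapping.keys (linext f x) \<subseteq> K"
  unfolding linext_def using assms by (intro order_trans[OF keys_sum]) blast

lemma keys_add_subset:
  "Poly_Mapping.keys x \<subseteq> K \<Longrightarrow> Poly_Mapping.keys y \<subseteq> K \<Longrightarrow> Poly_Mapping.keys (x + y) \<subseteq> K"
  using Poly_Mapping.keys_add[of x y] by blast

lemma keys_diff_subset:
  "Poly_Mapping.keys x \<subseteq> K \<Longrightarrow> Poly_Mapping.keys y \<subseteq> K \<Longrightarrow> Poly_Mapping.keys (x - y) \<subseteq> K"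
  using Poly_Mapping.keys_diff[of x y] by blast

lemma lookup_scale [simp]: "Poly_Mapping.lookup (scale c x) k = c * Poly_Mapping.lookup x k"
  by (simp add: scale_def Poly_Mapping.map.rep_eq when_def)

lemma keys_scale: "Poly_Mapping.keys (scale c x) \<subseteq> Poly_Mapping.keys x"
  by (auto simp: in_keys_iff)

lemma scale_single [simp]: "scale c (Poly_Mapping.single k d) = Poly_Mapping.single k (c * d)"
  by (rule poly_mapping_eqI) (simp add: lookup_single when_def)

lemma scale_scale [simp]: "scale c (scale d x) = scale (c * d) x"
  by (rule poly_mapping_eqI) (simp add: mult.assoc)

lemma additive_scale_left: "additive (\<lambda>c. scale c x)"
  and additive_scale_right: "additive (scale c)"
  by (simp_all add: additive_def poly_mapping_eq_iff fun_eq_iff lookup_add algebra_simps)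

lemma basis_algebra_simps [simp]:
  "carrier (basis_algebra B mul e) = {x. Poly_Mapping.keys x \<subseteq> B}"
  "\<one>\<^bsub>basis_algebra B mul e\<^esub> = Poly_Mapping.single e 1"
  "\<zero>\<^bsub>basis_algebra B mul e\<^esub> = 0"
  "x \<oplus>\<^bsub>basis_algebra B mul e\<^esub> y = x + y"
  by (simp_all add: basis_algebra_def)

lemma basis_algebra_mult:
  "x \<otimes>\<^bsub>basis_algebra B mul e\<^esub> y = linext (\<lambda>a c. linext (\<lambda>b d. scale (c * d) (mul a b)) y) x"
  by (simp add: basis_algebra_def linext_def)

lemma additive_basis_algebra_mult_left: "additive (\<lambda>x. x \<otimes>\<^bsub>basis_algebra B mul e\<^esub> y)"
  unfolding basis_algebra_mult
  by (intro additive_linext additive_linext_param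
      additive_compose[OF additive_scale_left] additive_mult_right)

lemma additive_basis_algebra_mult_right: "additive (\<lambda>y. x \<otimes>\<^bsub>basis_algebra B mul e\<^esub> y)"
  unfolding basis_algebra_mult
  by (intro additive_linext additive_linext_param
      additive_compose[OF additive_scale_left] additive_mult_left)

lemma basis_algebra_mult_single [simp]:
  "Poly_Mapping.single a c \<otimes>\<^bsub>basis_algebra B mul e\<^esub> Poly_Mapping.single b d
    = scale (c * d) (mul a b)"
  unfolding basis_algebra_mult
  by (simp add: linext_single additive_linext_param additive_compose[OF additive_scale_left]
      additive_mult_left additive_mult_right)

lemma basis_algebra_mult_scale:
  "x \<otimes>\<^bsub>basis_algebra B mul e\<^esub> scale c y = scale c (x \<otimes>\<^bsub>basis_algebra B mul e\<^esub> y)"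
proof (rule additive_eqI[where x = x and K = UNIV])
  fix a d
  show "Poly_Mapping.single a d \<otimes>\<^bsub>basis_algebra B mul e\<^esub> scale c y
      = scale c (Poly_Mapping.single a d \<otimes>\<^bsub>basis_algebra B mul e\<^esub> y)"
    by (rule additive_eqI[where x = y and K = UNIV])
      (simp_all add: additive_compose[OF additive_basis_algebra_mult_right additive_scale_right]
        additive_compose[OF additive_scale_right additive_basis_algebra_mult_right] mult_ac)
qed (simp_all add: additive_basis_algebra_mult_left
    additive_compose[OF additive_scale_right additive_basis_algebra_mult_left])

lemma keys_basis_algebra_mult:
  assumes "\<And>a b. a \<in> Poly_Mapping.keys x \<Longrightarrow> b \<in> Poly_Mapping.keys y \<Longrightarrow>
    Poly_Mapping.keys (mul a b) \<subseteq> K"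
  shows "Poly_Mapping.keys (x \<otimes>\<^bsub>basis_algebra B mul e\<^esub> y) \<subseteq> K"
  unfolding basis_algebra_mult by (intro keys_linext_subset order_trans[OF keys_scale] assms)

definition monoid_algebra :: "('k, 'b) monoid_scheme \<Rightarrow> ('k \<Rightarrow>\<^sub>0 'r::comm_ring_1) ring" where
  "monoid_algebra M =
    basis_algebra (carrier M) (\<lambda>u v. Poly_Mapping.single (u \<otimes>\<^bsub>M\<^esub> v) 1) \<one>\<^bsub>M\<^esub>"

lemma monoid_algebra_mult_assoc:
  fixes M (structure) and x y z :: "'k \<Rightarrow>\<^sub>0 'r::comm_ring_1"
  assumes "Group.monoid M" and keys: "Poly_Mapping.keys x \<subseteq> carrier M"
    "Poly_Mapping.keys y \<subseteq> carrier M" "Poly_Mapping.keys z \<subseteq> carrier M"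
  shows "x \<otimes>\<^bsub>monoid_algebra M\<^esub> y \<otimes>\<^bsub>monoid_algebra M\<^esub> z
    = x \<otimes>\<^bsub>monoid_algebra M\<^esub> (y \<otimes>\<^bsub>monoid_algebra M\<^esub> z)"
proof -
  let ?s = Poly_Mapping.single and ?A = "monoid_algebra M :: ('k \<Rightarrow>\<^sub>0 'r) ring"
  have add_left: "additive (\<lambda>x. x \<otimes>\<^bsub>?A\<^esub> y)"
    and add_right: "additive (\<lambda>y. x \<otimes>\<^bsub>?A\<^esub> y)" for x y
    unfolding monoid_algebra_def
    by (rule additive_basis_algebra_mult_left additive_basis_algebra_mult_right)+
  have single: "?s u c \<otimes>\<^bsub>?A\<^esub> ?s v d = ?s (u \<otimes> v) (c * d)" for u v c d
    by (simp add: monoid_algebra_def)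
  have singles: "?s u c \<otimes>\<^bsub>?A\<^esub> ?s v d \<otimes>\<^bsub>?A\<^esub> z = ?s u c \<otimes>\<^bsub>?A\<^esub> (?s v d \<otimes>\<^bsub>?A\<^esub> z)"
    if "u \<in> carrier M" "v \<in> carrier M" for u v c d
    by (rule additive_eqI[OF add_right additive_compose[OF add_right add_right] keys(3)])
      (simp add: single monoid.m_assoc[OF assms(1) that] mult.assoc)
  have left_single: "?s u c \<otimes>\<^bsub>?A\<^esub> y \<otimes>\<^bsub>?A\<^esub> z = ?s u c \<otimes>\<^bsub>?A\<^esub> (y \<otimes>\<^bsub>?A\<^esub> z)"
    if "u \<in> carrier M" for u c
    by (rule additive_eqI[OF additive_compose[OF add_left add_right]
          additive_compose[OF add_right add_left] keys(2)])
      (rule singles[OF that])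
  show ?thesis
    by (rule additive_eqI[OF additive_compose[OF add_left add_left] add_left keys(1)])
      (rule left_single)
qed

lemma ring_monoid_algebra:
  assumes "Group.monoid M"
  shows "ring (monoid_algebra M :: ('k \<Rightarrow>\<^sub>0 'r::comm_ring_1) ring)" (is "ring ?R")
proof (rule ringI)
  interpret M: Group.monoid M
    by (rule assms)
  show "abelian_group ?R"
  proof (rule abelian_groupI)
    fix x assume "x \<in> carrier ?R"
    then show "\<exists>y\<in>carrier ?R. y \<oplus>\<^bsub>?R\<^esub> x = \<zero>\<^bsub>?R\<^esub>"
      by (intro bexI[of _ "- x"]) (auto simp: monoid_algebra_def)
  qed (simp_all add: monoid_algebra_def add.assoc add.commute keys_add_subset)
  show "Group.monoid ?R"
  proof (rule monoidI)
    fix x y z assume "x \<in> carrier ?R" "y \<in> carrier ?R" "z \<in> carrier ?R"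
    then show "x \<otimes>\<^bsub>?R\<^esub> y \<otimes>\<^bsub>?R\<^esub> z = x \<otimes>\<^bsub>?R\<^esub> (y \<otimes>\<^bsub>?R\<^esub> z)"
      using monoid_algebra_mult_assoc[OF assms, of x y z] by (simp add: monoid_algebra_def)
  next
    fix x y assume "x \<in> carrier ?R" "y \<in> carrier ?R"
    then show "x \<otimes>\<^bsub>?R\<^esub> y \<in> carrier ?R"
      by (auto simp: monoid_algebra_def intro!: keys_basis_algebra_mult M.m_closed)
  next
    fix x assume "x \<in> carrier ?R"
    then have keys: "Poly_Mapping.keys x \<subseteq> carrier M"
      by (simp add: monoid_algebra_def)
    have additive_id: "additive (\<lambda>x :: 'k \<Rightarrow>\<^sub>0 'r. x)"
      by (simp add: additive_def)
    show "\<one>\<^bsub>?R\<^esub> \<otimes>\<^bsub>?R\<^esub> x = x"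
      unfolding monoid_algebra_def
      by (rule additive_eqI[OF additive_basis_algebra_mult_right additive_id keys]) simp
    show "x \<otimes>\<^bsub>?R\<^esub> \<one>\<^bsub>?R\<^esub> = x"
      unfolding monoid_algebra_def
      by (rule additive_eqI[OF additive_basis_algebra_mult_left additive_id keys]) simp
  qed (simp add: monoid_algebra_def)
qed (simp_all add: monoid_algebra_def additive.add[OF additive_basis_algebra_mult_left]
    additive.add[OF additive_basis_algebra_mult_right])

locale linear_monoid_action = Group.monoid M for M (structure) +
  fixes \<rho> :: "'a \<Rightarrow> ('k \<Rightarrow>\<^sub>0 'r::comm_ring_1) \<Rightarrow> ('k \<Rightarrow>\<^sub>0 'r)" and B :: "'k set"
  assumes additive_action: "additive (\<rho> u)"
    and action_scale: "\<rho> u (scale c y) = scale c (\<rho> u y)"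
    and action_mult: "u \<in> carrier M \<Longrightarrow> v \<in> carrier M \<Longrightarrow> \<rho> (u \<otimes> v) y = \<rho> u (\<rho> v y)"
    and keys_action:
      "u \<in> carrier M \<Longrightarrow> Poly_Mapping.keys y \<subseteq> B \<Longrightarrow> Poly_Mapping.keys (\<rho> u y) \<subseteq> B"
begin

definition algebra_action :: "('a \<Rightarrow>\<^sub>0 'r) \<Rightarrow> ('k \<Rightarrow>\<^sub>0 'r) \<Rightarrow> ('k \<Rightarrow>\<^sub>0 'r)" where
  "algebra_action p y = linext (\<lambda>u c. scale c (\<rho> u y)) p"

definition annihilator :: "('a \<Rightarrow>\<^sub>0 'r) set" where
  "annihilator = {p. Poly_Mapping.keys p \<subseteq> carrier M \<and>
    (\<forall>y. Poly_Mapping.keys y \<subseteq> B \<longrightarrow> algebra_action p y = 0)}"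

lemma algebra_action_single [simp]: "algebra_action (Poly_Mapping.single u c) y = scale c (\<rho> u y)"
  by (simp add: algebra_action_def linext_single additive_scale_left)

lemma additive_algebra_action_left: "additive (\<lambda>p. algebra_action p y)"
  unfolding algebra_action_def by (intro additive_linext additive_scale_left)

lemma additive_algebra_action_right: "additive (algebra_action p)"
proof -
  have "additive (\<lambda>y. linext (\<lambda>u c. scale c (\<rho> u y)) p)"
    by (intro additive_linext_param additive_compose[OF additive_scale_right] additive_action)
  then show ?thesis
    unfolding algebra_action_def .
qed

lemma algebra_action_mult:
  assumes p: "Poly_Mapping.keys p \<subseteq> carrier M" and q: "Poly_Mapping.keys q \<subseteq> carrier M"
  shows "algebra_action (p \<otimes>\<^bsub>monoid_algebra M\<^esub> q) y = algebra_action p (algebra_action q y)"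
proof -
  let ?s = Poly_Mapping.single and ?A = "monoid_algebra M :: ('a \<Rightarrow>\<^sub>0 'r) ring"
  have add_left: "additive (\<lambda>x. x \<otimes>\<^bsub>?A\<^esub> y)"
    and add_right: "additive (\<lambda>y. x \<otimes>\<^bsub>?A\<^esub> y)" for x y
    unfolding monoid_algebra_def
    by (rule additive_basis_algebra_mult_left additive_basis_algebra_mult_right)+
  note act_left = additive_algebra_action_left and act_right = additive_algebra_action_right
  have single: "algebra_action (?s u c \<otimes>\<^bsub>?A\<^esub> ?s v d) y
      = algebra_action (?s u c) (algebra_action (?s v d) y)"
    if "u \<in> carrier M" "v \<in> carrier M" for u v c d
    using that by (simp add: monoid_algebra_def action_mult action_scale)
  have left_single: "algebra_action (?s u c \<otimes>\<^bsub>?A\<^esub> q) y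
      = algebra_action (?s u c) (algebra_action q y)"
    if "u \<in> carrier M" for u c
    by (rule additive_eqI[OF additive_compose[OF act_left add_right]
          additive_compose[OF act_right act_left] q])
      (rule single[OF that])
  show ?thesis
    by (rule additive_eqI[OF additive_compose[OF act_left add_left] act_left p]) (rule left_single)
qed

lemma keys_algebra_action:
  assumes "Poly_Mapping.keys p \<subseteq> carrier M" "Poly_Mapping.keys y \<subseteq> B"
  shows "Poly_Mapping.keys (algebra_action p y) \<subseteq> B"
  unfolding algebra_action_def using assms
  by (intro keys_linext_subset order_trans[OF keys_scale] keys_action) auto

lemma ideal_annihilator: "ideal annihilator (monoid_algebra M)" (is "ideal _ ?A")
proof -
  interpret ring ?A
    by (rule ring_monoid_algebra) (rule monoid_axioms)
  have carrier: "carrier ?A = {p. Poly_Mapping.keys p \<subseteq> carrier M}"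
    by (simp add: monoid_algebra_def)
  show ?thesis
  proof (rule idealI[OF ring_axioms])
    show "subgroup annihilator (add_monoid ?A)"
    proof
      fix p assume p: "p \<in> annihilator"
      then have "\<ominus>\<^bsub>?A\<^esub> p = - p"
        by (intro minus_equality) (auto simp: annihilator_def monoid_algebra_def)
      then show "inv\<^bsub>add_monoid ?A\<^esub> p \<in> annihilator"
        unfolding a_inv_def[symmetric] using p
        by (simp add: annihilator_def additive.minus[OF additive_algebra_action_left])
    qed (auto simp: annihilator_def monoid_algebra_def keys_add_subset
        additive.add[OF additive_algebra_action_left] additive.zero[OF additive_algebra_action_left]
        intro: keys_add_subset[THEN subsetD])
  next
    fix p q assume "p \<in> annihilator" "q \<in> carrier ?A"
    then show "q \<otimes>\<^bsub>?A\<^esub> p \<in> annihilator" "p \<otimes>\<^bsub>?A\<^esub> q \<in> annihilator"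
      using m_closed[of p q] m_closed[of q p]
      by (simp_all add: annihilator_def carrier algebra_action_mult keys_algebra_action
          additive.zero[OF additive_algebra_action_right])
  qed
qed

end

definition words :: "'a set \<Rightarrow> 'a list monoid" where
  "words S = \<lparr>carrier = lists S, mult = (@), one = []\<rparr>"

lemma words_simps [simp]:
  "carrier (words S) = lists S" "u \<otimes>\<^bsub>words S\<^esub> v = u @ v" "\<one>\<^bsub>words S\<^esub> = []"
  by (simp_all add: words_def)

lemma monoid_words: "Group.monoid (words S)"
  by (rule monoidI) auto

lemma free_algebra_eq: "free_algebra n = monoid_algebra (words {1..<n})"
  by (simp add: free_algebra_def monoid_algebra_def)

section \<open>Matchings\<close>

definition matching_on :: "'a set \<Rightarrow> ('a \<Rightarrow> 'a) \<Rightarrow> bool" where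
  "matching_on X m \<longleftrightarrow> (\<forall>x. m (m x) = x) \<and> (\<forall>x. m x \<noteq> x \<longleftrightarrow> x \<in> X)"

lemma matching_on_invol: "matching_on X m \<Longrightarrow> m (m x) = x"
  by (simp add: matching_on_def)

lemma matching_on_fixfree: "matching_on X m \<Longrightarrow> x \<in> X \<Longrightarrow> m x \<noteq> x"
  by (simp add: matching_on_def)

lemma matching_on_inj: "matching_on X m \<Longrightarrow> m x = m y \<longleftrightarrow> x = y"
  using matching_on_invol by metis

lemma matching_on_swap: "matching_on X m \<Longrightarrow> m x = y \<longleftrightarrow> x = m y"
  using matching_on_invol by metis

lemma matching_on_closed: "matching_on X m \<Longrightarrow> m x \<in> X \<longleftrightarrow> x \<in> X"
  by (metis matching_on_def)

text \<open>Cutting the edges at \<open>a\<close> and \<open>b\<close> and joining \<open>a\<close> to \<open>b\<close> and the two loose ends to each other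
  is conjugation by a transposition, which is trivial if \<open>m a = b\<close>.\<close>

definition reconnect :: "'a \<Rightarrow> 'a \<Rightarrow> ('a \<Rightarrow> 'a) \<Rightarrow> 'a \<Rightarrow> 'a" where
  "reconnect a b m = transpose b (m a) \<circ> m \<circ> transpose b (m a)"

lemma reconnect_of_joined: "m a = b \<Longrightarrow> reconnect a b m = m"
  by (simp add: reconnect_def)

context
  fixes X :: "'a set" and m :: "'a \<Rightarrow> 'a" and a b :: 'a
  assumes m: "matching_on X m" and ab: "a \<in> X" "b \<in> X" "a \<noteq> b"
begin

lemma matching_on_reconnect: "matching_on X (reconnect a b m)"
proof -
  let ?t = "transpose b (m a)"
  have "?t y \<in> X \<longleftrightarrow> y \<in> X" for y
    using ab matching_on_closed[OF m, of a] by (auto simp: transpose_def)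
  moreover have "?t (m (?t y)) = y \<longleftrightarrow> m (?t y) = ?t y" for y
    by (metis transpose_involutory)
  ultimately show ?thesis
    using m by (simp add: matching_on_def reconnect_def)
qed

lemma reconnect_left: "reconnect a b m a = b"
  using ab matching_on_fixfree[OF m ab(1)] by (simp add: reconnect_def)

lemma reconnect_right: "reconnect a b m b = a"
  using reconnect_left matching_on_invol[OF matching_on_reconnect] by metis

lemma reconnect_mate_left: "m a \<noteq> b \<Longrightarrow> reconnect a b m (m a) = m b"
  using ab matching_on_fixfree[OF m ab(2)] matching_on_inj[OF m, of a b]
  by (simp add: reconnect_def transpose_def)

lemma reconnect_mate_right: "m a \<noteq> b \<Longrightarrow> reconnect a b m (m b) = m a"
  using reconnect_mate_left matching_on_invol[OF matching_on_reconnect] by metis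

lemma reconnect_other:
  "x \<notin> {a, b, m a, m b} \<Longrightarrow> reconnect a b m x = m x"
  using matching_on_swap[OF m, of x b] matching_on_inj[OF m, of x a]
  by (simp add: reconnect_def transpose_def)

end

lemma reconnect_cases:
  assumes "matching_on X m"
  obtains (left) "x = a" | (right) "x = b"
  | (mate_left) "m a \<noteq> b" "x = m a" | (mate_right) "m a \<noteq> b" "x = m b"
  | (other) "x \<notin> {a, b, m a, m b}"
  using matching_on_invol[OF assms, of a] by (metis insertE singletonD)

lemma reconnect_sym:
  assumes m: "matching_on X m" and ab: "a \<in> X" "b \<in> X" "a \<noteq> b"
  shows "reconnect b a m = reconnect a b m"
proof
  fix x
  have swap: "m b = a \<longleftrightarrow> m a = b"
    using matching_on_invol[OF m] by metis
  have ba: "b \<in> X" "a \<in> X" "b \<noteq> a"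
    using ab by auto
  note eval = reconnect_left[OF m] reconnect_right[OF m] reconnect_mate_left[OF m]
    reconnect_mate_right[OF m] reconnect_other[OF m]
  show "reconnect b a m x = reconnect a b m x"
    using m by (cases rule: reconnect_cases[where x = x and a = a and b = b])
      (simp_all add: eval ab ba swap)
qed

lemma reconnect_eq_sym_conj:
  assumes "matching_on X m" "a \<in> X" "b \<in> X" "a \<noteq> b"
  shows "reconnect a b m = transpose a (m b) \<circ> m \<circ> transpose a (m b)"
  using reconnect_sym[OF assms] by (simp add: reconnect_def)

text \<open>Both steps conjugate by the transposition of \<open>a\<close> and \<open>c\<close>.\<close>

lemma reconnect_undo_left:
  assumes m: "matching_on X m" and points: "a \<in> X" "b \<in> X" "c \<in> X" "a \<noteq> b" "b \<noteq> c"
    and joined: "m a = b"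
  shows "reconnect a b (reconnect b c m) = m"
proof -
  have "m b = a"
    using joined matching_on_invol[OF m] by metis
  then have step: "reconnect b c m = transpose a c \<circ> m \<circ> transpose a c"
    by (simp add: reconnect_def transpose_commute)
  have "reconnect b c m b = c"
    using reconnect_left[OF m] points by blast
  then have "reconnect a b (reconnect b c m)
      = transpose a c \<circ> reconnect b c m \<circ> transpose a c"
    using reconnect_eq_sym_conj[OF matching_on_reconnect[OF m]] points by metis
  then show ?thesis
    unfolding step by (simp add: fun_eq_iff)
qed

lemma reconnect_undo_right:
  assumes "matching_on X m" "a \<in> X" "b \<in> X" "c \<in> X" "a \<noteq> b" "b \<noteq> c" "m b = c"
  shows "reconnect b c (reconnect a b m) = m"
proof -
  have "m c = b"
    using assms(1,7) matching_on_invol by metis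
  then have "reconnect c b (reconnect b a m) = m"
    using assms by (intro reconnect_undo_left[of X]) auto
  then show ?thesis
    using assms reconnect_sym[of X] matching_on_reconnect[of X] by metis
qed

lemma reconnect_braid:
  assumes m: "matching_on X m" and points: "a \<in> X" "b \<in> X" "c \<in> X" "a \<noteq> b" "b \<noteq> c"
  shows "reconnect a b (reconnect b c (reconnect a b m)) = reconnect a b m"
    and "reconnect b c (reconnect a b (reconnect b c m)) = reconnect b c m"
  using points
  by (auto intro!: reconnect_undo_left reconnect_undo_right matching_on_reconnect reconnect_left m)

lemma reconnect_commute_unlinked:
  assumes m: "matching_on X m" and X: "a \<in> X" "b \<in> X" "c \<in> X" "d \<in> X"
    and distinct: "distinct [a, b, c, d]" and unlinked: "m a \<noteq> c" "m a \<noteq> d" "m b \<noteq> c"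
  shows "reconnect a b (reconnect c d m) = reconnect c d (reconnect a b m)"
    and "reconnect c d m a = m a" and "reconnect a b m c = m c"
proof -
  have mates: "m c \<noteq> a" "m d \<noteq> a" "m c \<noteq> b"
    using unlinked matching_on_swap[OF m] by metis+
  have apart: "m a \<noteq> m c" "m a \<noteq> m d" "m b \<noteq> m c"
    using distinct matching_on_inj[OF m] by auto
  show mate_a: "reconnect c d m a = m a"
    using distinct unlinked mates X by (intro reconnect_other[OF m]) auto
  show mate_c: "reconnect a b m c = m c"
    using distinct unlinked mates X by (intro reconnect_other[OF m]) auto
  have "{b, m a} \<inter> {d, m c} = {}"
    using distinct unlinked mates apart by auto
  then have "transpose b (m a) \<circ> transpose d (m c) = transpose d (m c) \<circ> transpose b (m a)"
    by (auto simp: fun_eq_iff transpose_def)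
  then show "reconnect a b (reconnect c d m) = reconnect c d (reconnect a b m)"
    unfolding reconnect_def[of a b "reconnect c d m"] reconnect_def[of c d "reconnect a b m"]
      mate_a mate_c
    unfolding reconnect_def by (metis comp_assoc)
qed

lemma reconnect_mates:
  assumes m: "matching_on X m" and ab: "a \<in> X" "b \<in> X" "a \<noteq> b" and "m a \<noteq> b"
  shows "reconnect (m a) (m b) m = reconnect a b m"
proof
  fix x
  have mates: "m a \<in> X" "m b \<in> X" "m a \<noteq> m b"
    using ab matching_on_closed[OF m] matching_on_inj[OF m] by auto
  note eval = reconnect_left[OF m] reconnect_right[OF m] reconnect_mate_left[OF m]
    reconnect_mate_right[OF m] reconnect_other[OF m]
  have "m (m a) \<noteq> m b"
    using assms(5) matching_on_inj[OF m] by auto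
  with m show "reconnect (m a) (m b) m x = reconnect a b m x"
    using eval(3,4)[OF mates] matching_on_invol[OF m]
    by (cases rule: reconnect_cases[where x = x and a = a and b = b])
      (simp_all add: eval ab mates assms(5))
qed

lemma reconnect_commute_linked:
  assumes m: "matching_on X m" and X: "a \<in> X" "b \<in> X" "c \<in> X" "d \<in> X"
    and distinct: "distinct [a, b, c, d]" and linked: "m a \<in> {c, d}" "m b \<in> {c, d}"
  shows "reconnect c d m = reconnect a b m"
proof -
  have "m a \<noteq> m b" "m a \<noteq> b"
    using distinct linked matching_on_inj[OF m] by auto
  then consider "m a = c" "m b = d" | "m a = d" "m b = c"
    using linked by auto
  then show ?thesis
    using reconnect_mates[OF m X(1,2)] reconnect_sym[OF m X(3,4)] distinct \<open>m a \<noteq> b\<close> by cases auto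
qed

lemma reconnect_unordered:
  assumes m: "matching_on X m" and ab: "a \<in> X" "b \<in> X" "a \<noteq> b" and pair: "{x, y} = {a, b}"
  shows "reconnect x y m = reconnect a b m" and "m x = y \<longleftrightarrow> m a = b"
  using pair reconnect_sym[OF m ab] matching_on_swap[OF m, of b a]
  by (auto simp: doubleton_eq_iff)

lemma reconnect_commute:
  assumes m: "matching_on X m" and X: "a \<in> X" "b \<in> X" "c \<in> X" "d \<in> X"
    and distinct: "distinct [a, b, c, d]"
  shows "reconnect a b (reconnect c d m) = reconnect c d (reconnect a b m)" (is ?commute)
    and "of_bool (m c = d) + of_bool (reconnect c d m a = b)
      = (of_bool (m a = b) + of_bool (reconnect a b m c = d) :: nat)" (is ?count)
proof -
  consider (linked) "m a \<in> {c, d}" "m b \<in> {c, d}"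
    | (unlinked) x y z w where "{x, y} = {a, b}" "{z, w} = {c, d}" "m x \<noteq> z" "m x \<noteq> w" "m y \<noteq> z"
    using distinct matching_on_inj[OF m, of a b] that(1) that(2)[of a b c d]
      that(2)[of a b d c] that(2)[of b a c d] that(2)[of b a d c] by (auto simp: insert_commute)
  then have "?commute \<and> ?count"
  proof cases
    case linked
    have "c = m a \<or> c = m b" "m a \<noteq> b"
      using linked distinct matching_on_inj[OF m, of a b] by auto
    then have "m a \<noteq> b" "m c \<noteq> d"
      using distinct matching_on_invol[OF m] by auto
    moreover have "reconnect a b m a = b" "reconnect c d m c = d"
      using reconnect_left[OF m] X distinct by auto
    ultimately show ?thesis
      unfolding reconnect_commute_linked[OF m X distinct linked]
      by (simp add: reconnect_of_joined)
  next
    case unlinked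
    have "distinct [x, y, z, w]" "x \<in> X" "y \<in> X" "z \<in> X" "w \<in> X"
      using unlinked(1,2) distinct X by (auto simp: doubleton_eq_iff)
    note commute = reconnect_commute_unlinked[OF m this(2-5,1) unlinked(3-5)]
    have "a \<noteq> b" "c \<noteq> d"
      using distinct by auto
    note ab = reconnect_unordered[OF _ X(1,2) this(1) unlinked(1)]
      and cd = reconnect_unordered[OF _ X(3,4) this(2) unlinked(2)]
      and after_ab = matching_on_reconnect[OF m X(1,2) this(1)]
      and after_cd = matching_on_reconnect[OF m X(3,4) this(2)]
    show ?thesis
      using commute unfolding ab(1)[OF m] cd(1)[OF m] ab(1)[OF after_cd] cd(1)[OF after_ab]
      by (simp add: ab(2)[OF m, symmetric] cd(2)[OF m, symmetric]
          ab(2)[OF after_cd, symmetric] cd(2)[OF after_ab, symmetric])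
  qed
  then show ?commute ?count
    by blast+
qed

section \<open>Two involutions\<close>

text \<open>A glued system of arcs: \<open>m\<close> exchanges the ends of every arc and \<open>g\<close> the two points of every
  joint; the fixed points of \<open>g\<close> in \<open>X\<close> are the free ends.\<close>

locale involution_pair =
  fixes X :: "'a set" and m g :: "'a \<Rightarrow> 'a"
  assumes finite: "finite X"
    and matching: "matching_on X m"
    and glue_invol [simp]: "g (g x) = x"
    and glue_support: "g x \<noteq> x \<Longrightarrow> x \<in> X"
begin

definition adj :: "'a rel" where
  "adj = {(x, y). x \<noteq> y \<and> (y = m x \<or> y = g x)}"

definition advance :: "'a \<Rightarrow> 'a" where
  "advance x = g (m x)"

definition closed_components :: "'a set set" where
  "closed_components = {C \<in> X // adj\<^sup>*. \<forall>x\<in>C. g x \<noteq> x}"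

lemma match_invol [simp]: "m (m x) = x"
  using matching by (rule matching_on_invol)

lemma match_in [simp]: "m x \<in> X \<longleftrightarrow> x \<in> X"
  using matching by (rule matching_on_closed)

lemma glue_in [simp]: "g x \<in> X \<longleftrightarrow> x \<in> X"
  using glue_support glue_invol by metis

lemma advance_in: "(advance ^^ k) x \<in> X \<longleftrightarrow> x \<in> X"
  by (induction k) (simp_all add: advance_def)

lemma match_advance: "m (g (advance x)) = x"
  by (simp add: advance_def)

lemma inj_advance_pow: "inj (advance ^^ k)"
  by (intro inj_fn injI) (metis match_advance)

lemma advance_periodic:
  assumes "x \<in> X"
  obtains k where "k > 0" "(advance ^^ k) x = x"
proof (rule funpow_inj_finite[of advance x])
  show "inj advance"
    using inj_advance_pow[of 1] by simp
  have "{y. \<exists>k. y = (advance ^^ k) x} \<subseteq> X"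
    using assms advance_in by blast
  then show "finite {y. \<exists>k. y = (advance ^^ k) x}"
    using finite by (rule finite_subset)
qed (use that in blast)

lemma adj_sym: "(x, y) \<in> adj\<^sup>* \<Longrightarrow> (y, x) \<in> adj\<^sup>*"
proof -
  have "sym adj"
    by (auto simp: adj_def sym_def)
  then show "(x, y) \<in> adj\<^sup>* \<Longrightarrow> (y, x) \<in> adj\<^sup>*"
    using sym_rtrancl by (meson symD)
qed

lemma adj_match: "(x, m x) \<in> adj\<^sup>*" and adj_glue: "(x, g x) \<in> adj\<^sup>*"
  by (cases "m x = x"; cases "g x = x"; auto simp: adj_def)+

lemma adj_advance: "(x, (advance ^^ k) x) \<in> adj\<^sup>*"
proof (induction k)
  case (Suc k)
  then show ?case
    using adj_match adj_glue by (simp add: advance_def) (meson rtrancl_trans)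
qed simp

lemma component_subset:
  assumes "(x, y) \<in> adj\<^sup>*" "x \<in> S" "\<And>z. z \<in> S \<Longrightarrow> m z \<in> S" "\<And>z. z \<in> S \<Longrightarrow> g z \<in> S"
  shows "y \<in> S"
  using assms(1,2) by (induction rule: rtrancl_induct) (auto simp: adj_def assms(3,4))

lemma component_in: "(x, y) \<in> adj\<^sup>* \<Longrightarrow> x \<in> X \<Longrightarrow> y \<in> X"
  by (erule component_subset) simp_all

lemma component_eq_orbit:
  assumes "x \<in> X" "(x, y) \<in> adj\<^sup>*"
  obtains k where "y = (advance ^^ k) x" | k where "y = g ((advance ^^ k) x)"
proof -
  have "y \<in> range (\<lambda>k. (advance ^^ k) x) \<union> range (\<lambda>k. g ((advance ^^ k) x))" (is "_ \<in> ?S")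
    using assms(2)
  proof (rule component_subset)
    show "x \<in> ?S"
      by (auto intro: range_eqI[of _ _ 0])
    fix z assume "z \<in> ?S"
    then obtain k where k: "z = (advance ^^ k) x \<or> z = g ((advance ^^ k) x)"
      by blast
    then show "g z \<in> ?S"
      by auto
    obtain k' where k': "(advance ^^ k) x = advance ((advance ^^ k') x)"
    proof (cases k)
      case 0
      then show ?thesis
        using advance_periodic[OF assms(1)] that
        by (metis gr0_conv_Suc funpow.simps(2) o_apply funpow_0)
    qed (use that in simp)
    have "m ((advance ^^ k) x) = g ((advance ^^ Suc k) x)"
      by (simp add: advance_def)
    moreover have "m (g ((advance ^^ k) x)) = (advance ^^ k') x"
      unfolding k' by (rule match_advance)
    ultimately have "m z = g ((advance ^^ Suc k) x) \<or> m z = (advance ^^ k') x"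
      using k by metis
    then show "m z \<in> ?S"
      by blast
  qed
  then show ?thesis
    using that by blast
qed

lemma advance_glue_advance: "(advance ^^ k) (g ((advance ^^ k) x)) = g x"
proof (induction k)
  case (Suc k)
  have "advance (g (advance y)) = g y" for y
    by (simp add: advance_def)
  then show ?case
    using Suc by (simp add: funpow_swap1[of advance k "g _"])
qed simp

text \<open>Conjugation by \<open>g\<close> inverts \<open>advance\<close>, so the midpoint of a path from \<open>x\<close> to \<open>g x\<close> is fixed by
  \<open>g\<close> or by \<open>m\<close>.\<close>

lemma advance_eq_glue:
  assumes x: "x \<in> X" and eq: "(advance ^^ k) x = g x"
  obtains j where "k = 2 * j" "g ((advance ^^ j) x) = (advance ^^ j) x"
proof (cases "even k")
  case True
  then obtain j where j: "k = 2 * j" ..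
  then have "(advance ^^ j) ((advance ^^ j) x) = (advance ^^ j) (g ((advance ^^ j) x))"
    using eq by (simp add: advance_glue_advance funpow_add mult_2)
  then show ?thesis
    using that j injD[OF inj_advance_pow] by metis
next
  case False
  then obtain j where "k = 2 * j + 1" ..
  then have "k = j + Suc j"
    by simp
  define y where "y = (advance ^^ j) x"
  have "(advance ^^ j) (advance y) = (advance ^^ j) (g y)"
    using eq advance_glue_advance[of j x] \<open>k = j + Suc j\<close>
    by (simp add: y_def funpow_add funpow_swap1)
  then have "g (m y) = g y"
    using injD[OF inj_advance_pow] by (metis advance_def)
  then have "m y = y"
    by (metis glue_invol)
  moreover have "y \<in> X"
    using x by (simp add: y_def advance_in)
  ultimately show ?thesis
    using matching_on_fixfree[OF matching] by blast
qed

definition exits_at :: "'a \<Rightarrow> nat \<Rightarrow> bool" where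
  "exits_at x k \<longleftrightarrow> g (m ((advance ^^ k) x)) = m ((advance ^^ k) x) \<and>
    (\<forall>j<k. g (m ((advance ^^ j) x)) \<noteq> m ((advance ^^ j) x))"

lemma exits_at_exists:
  assumes "x \<in> X" "g x = x"
  obtains k where "exits_at x k"
proof -
  obtain l where "l > 0" "(advance ^^ l) x = x"
    using assms(1) by (rule advance_periodic)
  then obtain k where "g (m ((advance ^^ k) x)) = x"
    by (metis advance_def gr0_conv_Suc funpow.simps(2) o_apply)
  then have "g (m ((advance ^^ k) x)) = m ((advance ^^ k) x)"
    using assms(2) by (metis glue_invol)
  then show ?thesis
    using that[of "LEAST k. g (m ((advance ^^ k) x)) = m ((advance ^^ k) x)"] LeastI not_less_Least
    unfolding exits_at_def by (metis (mono_tags, lifting))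
qed

lemma component_of_free_end:
  assumes free: "g x = x" and exit: "exits_at x k" and y: "(x, y) \<in> adj\<^sup>*"
  obtains (orbit) j where "j \<le> k" "y = (advance ^^ j) x"
  | (mate) j where "j \<le> k" "y = m ((advance ^^ j) x)"
proof -
  let ?S = "(\<lambda>j. (advance ^^ j) x) ` {..k} \<union> (\<lambda>j. m ((advance ^^ j) x)) ` {..k}"
  have "y \<in> ?S"
    using y
  proof (rule component_subset)
    show "x \<in> ?S"
      by (auto intro: image_eqI[of _ _ 0])
    show "m z \<in> ?S" if "z \<in> ?S" for z
      using that by auto
    show "g z \<in> ?S" if z: "z \<in> ?S" for z
    proof -
      from z consider (orbit) j where "j \<le> k" "z = (advance ^^ j) x"
        | (mate) j where "j \<le> k" "z = m ((advance ^^ j) x)"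
        by blast
      then show ?thesis
      proof cases
        case (orbit j)
        then show ?thesis
          using free by (cases j) (auto simp: advance_def intro: image_eqI[of _ _ 0])
      next
        case (mate j)
        then have "g z = z \<or> Suc j \<in> {..k} \<and> g z = (advance ^^ Suc j) x"
          using exit by (cases "j = k") (auto simp: exits_at_def advance_def)
        then show ?thesis
          using z by blast
      qed
    qed
  qed
  then show ?thesis
    using that by blast
qed

lemma free_ends_of_component:
  assumes free: "g x = x" and exit: "exits_at x k" and y: "(x, y) \<in> adj\<^sup>*" "g y = y"
  shows "y = x \<or> y = m ((advance ^^ k) x)"
proof -
  have only_exit: "j = k" if "j \<le> k" "y = m ((advance ^^ j) x)" for j
    using exit y(2) that by (cases "j = k") (auto simp: exits_at_def)
  show ?thesis
    using free exit y(1)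
  proof (cases rule: component_of_free_end)
    case (orbit j)
    show ?thesis
    proof (cases j)
      case (Suc i)
      then have "y = m ((advance ^^ i) x)"
        using orbit(2) y(2) by (simp add: advance_def)
      then show ?thesis
        using only_exit[of i] orbit(1) Suc by simp
    qed (use orbit in simp)
  next
    case (mate j)
    then show ?thesis
      using only_exit by blast
  qed
qed

lemma free_mate_unique:
  assumes "x \<in> X" "g x = x"
    and "(x, y) \<in> adj\<^sup>*" "g y = y" "y \<noteq> x"
    and "(x, z) \<in> adj\<^sup>*" "g z = z" "z \<noteq> x"
  shows "y = z"
proof -
  obtain k where "exits_at x k"
    using assms(1,2) by (rule exits_at_exists)
  then show ?thesis
    using free_ends_of_component[OF assms(2)] assms(3-8) by metis
qed

end

section \<open>Canonical labels\<close>

text \<open>The horizontal displacement along \<open>\<alpha>\<close>, run from its smaller to its larger end, up to the sign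
  \<open>-1\<close> if \<open>\<alpha>\<close> starts on the side \<open>1\<close>.  The double sum has only one nonzero summand.\<close>

definition canonical_label :: "pt set \<Rightarrow> int" where
  "canonical_label \<alpha> =
    (\<Sum>p\<in>\<alpha>. \<Sum>q\<in>\<alpha>. if pt_less p q then (- 1) ^ fst p * (int (snd q) - int (snd p)) else 0)"

lemma pt_less_asym: "pt_less p q \<Longrightarrow> \<not> pt_less q p"
  by (cases p; cases q) (simp add: pt_less_def split: if_splits; linarith)

lemma pt_less_total: "p \<noteq> q \<Longrightarrow> \<not> pt_less p q \<Longrightarrow> pt_less q p"
  by (cases p; cases q) (simp add: pt_less_def split: if_splits; linarith)

lemma canonical_label_less:
  assumes "pt_less p q"
  shows "canonical_label {p, q} = (- 1) ^ fst p * (int (snd q) - int (snd p))"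
proof -
  have "p \<noteq> q" "\<not> pt_less q p" "\<not> pt_less p p" "\<not> pt_less q q"
    using assms pt_less_asym by metis+
  then show ?thesis
    using assms by (simp add: canonical_label_def)
qed

lemma parity_doubleton: "parity {p, q} = (if fst p = fst q then - 1 else 1)"
  unfolding parity_def by (cases p; cases q) (auto simp: doubleton_eq_iff)

lemma cumulated_parity_eq:
  "cumulated_parity w i
    = (\<Prod>j<i. parity (edge w j)) * (if pt_less (src w i) (tgt w i) then 1 else parity (edge w i))"
  by (simp add: cumulated_parity_def lessThan_Suc_atMost[symmetric])

lemma parity_canonical_label:
  assumes "p \<noteq> q" "fst p \<le> 1" "fst q \<le> 1"
  shows "(if pt_less p q then 1 else parity {p, q}) * canonical_label {p, q}
    = (- 1) ^ fst p * (int (snd q) - int (snd p))"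
proof (cases "pt_less p q")
  case False
  then have less: "pt_less q p"
    using assms pt_less_total by metis
  then have "canonical_label {p, q} = (- 1) ^ fst q * (int (snd p) - int (snd q))"
    using canonical_label_less[OF less] by (simp add: insert_commute)
  moreover have "fst p = fst q \<or> fst p = 1 \<and> fst q = 0"
    using less assms by (auto simp: pt_less_def)
  ultimately show ?thesis
    using False by (auto simp: parity_doubleton right_diff_distrib)
qed (simp add: canonical_label_less)

lemma prod_parity_telescope:
  assumes "i < length w"
    and ends: "\<And>j. j < length w \<Longrightarrow> fst (src w j) \<le> 1 \<and> fst (tgt w j) \<le> 1"
    and joint: "\<And>j. Suc j < length w \<Longrightarrow> fst (src w (Suc j)) = 1 - fst (tgt w j)"
  shows "(\<Prod>j<i. parity (edge w j)) * (- 1) ^ fst (src w i) = (- 1) ^ fst (src w 0)"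
  using assms(1)
proof (induction i)
  case (Suc i)
  have "fst (src w i) = 0 \<or> fst (src w i) = 1" "fst (tgt w i) = 0 \<or> fst (tgt w i) = 1"
    using ends[of i] Suc.prems by auto
  then have "parity (edge w i) * (- 1) ^ fst (src w (Suc i)) = (- 1) ^ fst (src w i)"
    using joint[OF Suc.prems] by (auto simp: parity_doubleton)
  then show ?case
    using Suc by (simp add: mult.assoc)
qed simp

lemma label_sum_telescope:
  assumes "w \<noteq> []"
    and ends: "\<And>j. j < length w \<Longrightarrow> src w j \<noteq> tgt w j \<and> fst (src w j) \<le> 1 \<and> fst (tgt w j) \<le> 1"
    and label: "\<And>j. j < length w \<Longrightarrow> f (tag w j) (edge w j) = canonical_label (edge w j)"
    and joint: "\<And>j. Suc j < length w \<Longrightarrow> snd (src w (Suc j)) = snd (tgt w j) \<and>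
      fst (src w (Suc j)) = 1 - fst (tgt w j)"
  shows "label_sum f w =
    (- 1) ^ fst (src w 0) * (int (snd (tgt w (length w - 1))) - int (snd (src w 0)))"
proof -
  let ?step = "\<lambda>j. int (snd (tgt w j)) - int (snd (src w j))"
  have summand: "cumulated_parity w j * f (tag w j) (edge w j) = (- 1) ^ fst (src w 0) * ?step j"
    if "j < length w" for j
    using parity_canonical_label[of "src w j" "tgt w j"] ends[OF that] label[OF that]
      prod_parity_telescope[OF that] ends joint
    unfolding cumulated_parity_eq by (simp add: mult.assoc)
  have "(\<Sum>j<Suc k. ?step j) = int (snd (tgt w k)) - int (snd (src w 0))" if "k < length w" for k
    using that by (induction k) (use joint in auto)
  from this[of "length w - 1"]
  have "(\<Sum>j<length w. ?step j) = int (snd (tgt w (length w - 1))) - int (snd (src w 0))"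
    using assms(1) by simp
  then show ?thesis
    by (simp add: label_sum_def summand sum_distrib_left[symmetric])
qed

section \<open>Walks along glued arcs\<close>

text \<open>Both the gluing of two tangles and the closure of one tangle are instances, with \<open>sheet\<close>
  giving the tag of a point and \<open>place\<close> the underlying point of the tangle.\<close>

locale gluing = involution_pair X m g for X :: "'a set" and m g :: "'a \<Rightarrow> 'a" +
  fixes sheet :: "'a \<Rightarrow> 's" and place :: "'a \<Rightarrow> pt"
  assumes sheet_match: "sheet (m x) = sheet x"
    and sheet_place_inj: "sheet x = sheet y \<Longrightarrow> place x = place y \<Longrightarrow> x = y"
    and fst_place: "x \<in> X \<Longrightarrow> fst (place x) = 0 \<or> fst (place x) = 1"
    and place_glue: "g x \<noteq> x \<Longrightarrow>
      fst (place (g x)) = 1 - fst (place x) \<and> snd (place (g x)) = snd (place x)"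
    and same_column: "g x \<noteq> x \<Longrightarrow> g y \<noteq> y \<Longrightarrow> snd (place x) = snd (place y) \<Longrightarrow> y = x \<or> y = g x"
begin

definition orbit_walk :: "'a \<Rightarrow> nat \<Rightarrow> 's walk" where
  "orbit_walk x l =
    map (\<lambda>y. (sheet y, place y, place (m y))) (map (\<lambda>j. (advance ^^ j) x) [0..<l])"

definition canonically_labelled :: "('s \<Rightarrow> pt set \<Rightarrow> int) \<Rightarrow> bool" where
  "canonically_labelled f \<longleftrightarrow>
    (\<forall>x\<in>X. f (sheet x) {place x, place (m x)} = canonical_label {place x, place (m x)})"

lemma length_orbit_walk [simp]: "length (orbit_walk x l) = l"
  by (simp add: orbit_walk_def)

lemma orbit_walk_eq_Nil [simp]: "orbit_walk x l = [] \<longleftrightarrow> l = 0"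
  by (simp add: orbit_walk_def)

lemma orbit_walk_nth [simp]:
  "j < l \<Longrightarrow> orbit_walk x l ! j =
    (sheet ((advance ^^ j) x), place ((advance ^^ j) x), place (m ((advance ^^ j) x)))"
  by (simp add: orbit_walk_def)

lemma orbit_walk_eqI:
  assumes start: "w \<noteq> [] \<Longrightarrow> tag w 0 = sheet x \<and> src w 0 = place x"
    and arc: "\<And>j y. j < length w \<Longrightarrow> tag w j = sheet y \<Longrightarrow> src w j = place y \<Longrightarrow> tgt w j = place (m y)"
    and joint: "\<And>j y. Suc j < length w \<Longrightarrow> tag w j = sheet y \<Longrightarrow> src w j = place y \<Longrightarrow>
      tag w (Suc j) = sheet (advance y) \<and> src w (Suc j) = place (advance y)"
  shows "w = orbit_walk x (length w)"
proof (rule nth_equalityI)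
  have point: "tag w j = sheet ((advance ^^ j) x) \<and> src w j = place ((advance ^^ j) x)"
    if "j < length w" for j
    using that
  proof (induction j)
    case 0
    then show ?case
      using start by auto
  next
    case (Suc j)
    then show ?case
      using joint[of j "(advance ^^ j) x"] by simp
  qed
  fix j assume "j < length w"
  then show "w ! j = orbit_walk x (length w) ! j"
    using point arc[of j "(advance ^^ j) x"] by (simp add: prod_eq_iff)
qed simp

lemma place_joint:
  assumes "g (m x) \<noteq> m x"
  shows "fst (place (advance x)) = 1 - fst (place (m x)) \<and>
    snd (place (advance x)) = snd (place (m x))"
  using place_glue[OF assms] by (simp add: advance_def)

lemma label_sum_orbit_walk:
  assumes x: "x \<in> X" and "l > 0"
    and joint: "\<And>j. Suc j < l \<Longrightarrow> g (m ((advance ^^ j) x)) \<noteq> m ((advance ^^ j) x)"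
    and label: "canonically_labelled f"
  shows "label_sum f (orbit_walk x l) = (- 1) ^ fst (place x) *
    (int (snd (place (m ((advance ^^ (l - 1)) x)))) - int (snd (place x)))"
proof -
  have orbit: "(advance ^^ j) x \<in> X" for j
    using x by (simp add: advance_in)
  have ends: "place y \<noteq> place (m y) \<and> fst (place y) \<le> 1 \<and> fst (place (m y)) \<le> 1" if "y \<in> X" for y
    using that fst_place[of y] fst_place[of "m y"] sheet_place_inj[of y "m y"] sheet_match
      matching_on_fixfree[OF matching that] by auto
  let ?w = "orbit_walk x l"
  have "label_sum f ?w = (- 1) ^ fst (src ?w 0) *
    (int (snd (tgt ?w (length ?w - 1))) - int (snd (src ?w 0)))"
    by (rule label_sum_telescope)
      (use \<open>l > 0\<close> place_joint[OF joint] ends[OF orbit] label orbit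
        in \<open>auto simp: canonically_labelled_def\<close>)
  then show ?thesis
    using \<open>l > 0\<close> by simp
qed

abbreviation column :: "'a \<Rightarrow> nat" where
  "column x \<equiv> snd (place x)"

text \<open>A closed component is run through in two ways, and each point is a possible start.  The
  conventions on cycles single out one start: the point of least column on the side \<open>a\<close>.\<close>

definition cycle_start :: "nat \<Rightarrow> 'a \<Rightarrow> nat \<Rightarrow> bool" where
  "cycle_start a p l \<longleftrightarrow> p \<in> X \<and> fst (place p) = a \<and> l > 0 \<and> (advance ^^ l) p = p \<and>
    (\<forall>j<l. g ((advance ^^ j) p) \<noteq> (advance ^^ j) p) \<and>
    (\<forall>j. 0 < j \<and> j < l \<longrightarrow> column p < column ((advance ^^ j) p))"

definition cycle_walks :: "nat \<Rightarrow> 's walk set" where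
  "cycle_walks a = {orbit_walk p l | p l. cycle_start a p l}"

lemma cycle_start_component:
  assumes p: "cycle_start a p l" and q: "(p, q) \<in> adj\<^sup>*"
  shows "column p \<le> column q" and "g q \<noteq> q"
proof -
  obtain k where k: "q = (advance ^^ k) p \<or> q = g ((advance ^^ k) p)"
    using p q component_eq_orbit unfolding cycle_start_def by metis
  define y where "y = (advance ^^ (k mod l)) p"
  have y: "(advance ^^ k) p = y"
    using p by (simp add: y_def cycle_start_def funpow_mod_eq)
  have nonfree: "g y \<noteq> y"
    using p by (simp add: y_def cycle_start_def)
  then show "g q \<noteq> q"
    using k unfolding y by auto
  have "column p \<le> column y"
    using p unfolding y_def cycle_start_def by (cases "k mod l = 0") (auto intro: less_imp_le)
  then show "column p \<le> column q"
    using k place_glue[OF nonfree] unfolding y by auto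
qed

lemma cycle_start_joint:
  assumes "cycle_start a p l"
  shows "g ((advance ^^ j) p) \<noteq> (advance ^^ j) p"
    and "g (m ((advance ^^ j) p)) \<noteq> m ((advance ^^ j) p)"
  using cycle_start_component(2)[OF assms adj_advance]
    cycle_start_component(2)[OF assms rtrancl_trans[OF adj_advance adj_match]] by blast+

lemma cycle_start_step:
  assumes "cycle_start a p l"
  shows "fst (place ((advance ^^ Suc j) p)) = 1 - fst (place (m ((advance ^^ j) p)))"
    and "column ((advance ^^ Suc j) p) = column (m ((advance ^^ j) p))"
  using place_joint[OF cycle_start_joint(2)[OF assms]] by simp_all

lemma cycle_start_closes:
  assumes "cycle_start a p l"
  shows "fst (place (m ((advance ^^ (l - 1)) p))) = 1 - a"
    and "column (m ((advance ^^ (l - 1)) p)) = column p"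
proof -
  have "Suc (l - 1) = l" "p \<in> X" "(advance ^^ l) p = p" "fst (place p) = a"
    using assms by (auto simp: cycle_start_def)
  then show "column (m ((advance ^^ (l - 1)) p)) = column p"
    and "fst (place (m ((advance ^^ (l - 1)) p))) = 1 - a"
    using cycle_start_step[OF assms, of "l - 1"] fst_place[of "m ((advance ^^ (l - 1)) p)"]
    by (auto simp: advance_in)
qed

lemma cycle_start_least:
  assumes "cycle_start a p l" "Suc j < l"
  shows "column p < column (m ((advance ^^ j) p))"
  using assms cycle_start_step(2)[OF assms(1), of j] unfolding cycle_start_def
  by (metis zero_less_Suc)

lemma label_sum_cycle_walk:
  assumes w: "w \<in> cycle_walks a" and label: "canonically_labelled f"
  shows "label_sum f w = 0"
proof -
  obtain p l where p: "cycle_start a p l" "w = orbit_walk p l"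
    using w by (auto simp: cycle_walks_def)
  then have "p \<in> X" "l > 0"
    by (simp_all add: cycle_start_def)
  then show ?thesis
    using label_sum_orbit_walk[OF _ _ cycle_start_joint(2)[OF p(1)] label]
      cycle_start_closes(2)[OF p(1)] by (simp add: p(2))
qed

lemma cycle_start_unique:
  assumes p: "cycle_start a p l" and p': "cycle_start a p' l'" and "(p, p') \<in> adj\<^sup>*"
  shows "p = p' \<and> l = l'"
proof -
  have "column p = column p'"
    using cycle_start_component(1)[OF p assms(3)]
      cycle_start_component(1)[OF p' adj_sym[OF assms(3)]] by (rule order_antisym)
  moreover have "g p \<noteq> p" "g p' \<noteq> p'" and side: "fst (place p) = a" "fst (place p') = a"
    using p p' by (auto simp: cycle_start_def)
  ultimately have "p' = p \<or> p' = g p"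
    using same_column by blast
  moreover have "fst (place (g p)) \<noteq> a"
    using place_glue[OF \<open>g p \<noteq> p\<close>] side fst_place[of p] p by (auto simp: cycle_start_def)
  ultimately have "p = p'"
    using side by auto
  moreover have "\<not> l < l'" "\<not> l' < l"
    using p p' \<open>p = p'\<close> by (auto simp: cycle_start_def)
  ultimately show ?thesis
    by simp
qed

lemma least_period:
  assumes "x \<in> X"
  obtains l where "l > 0" "(advance ^^ l) x = x" "\<And>j. 0 < j \<Longrightarrow> j < l \<Longrightarrow> (advance ^^ j) x \<noteq> x"
proof -
  let ?P = "\<lambda>k. 0 < k \<and> (advance ^^ k) x = x"
  obtain k where "?P k"
    using advance_periodic[OF assms] by blast
  then have "?P (LEAST k. ?P k)"
    by (rule LeastI)
  then show ?thesis
    using that[of "LEAST k. ?P k"] not_less_Least[of _ ?P] by blast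
qed

lemma cycle_start_exists:
  assumes x: "x \<in> X" and closed: "\<And>y. (x, y) \<in> adj\<^sup>* \<Longrightarrow> g y \<noteq> y" and a: "a \<le> 1"
  obtains p l where "cycle_start a p l" "(x, p) \<in> adj\<^sup>*"
proof -
  obtain y where y: "(x, y) \<in> adj\<^sup>*" "\<And>z. (x, z) \<in> adj\<^sup>* \<Longrightarrow> column y \<le> column z"
    using ex_has_least_nat[of "\<lambda>y. (x, y) \<in> adj\<^sup>*" x column] by blast
  define p where "p = (if fst (place y) = a then y else g y)"
  have xp: "(x, p) \<in> adj\<^sup>*"
    using y(1) adj_glue[of y] by (auto simp: p_def)
  have p: "p \<in> X" "fst (place p) = a" "column p = column y"
    using component_in[OF y(1) x] fst_place[of y] place_glue[OF closed[OF y(1)]] a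
    by (auto simp: p_def)
  obtain l where l: "l > 0" "(advance ^^ l) p = p" "\<And>j. 0 < j \<Longrightarrow> j < l \<Longrightarrow> (advance ^^ j) p \<noteq> p"
    by (rule least_period[OF p(1)]) blast
  have orbit: "(x, (advance ^^ j) p) \<in> adj\<^sup>*" for j
    using rtrancl_trans[OF xp adj_advance] .
  have "column p < column ((advance ^^ j) p)" if j: "0 < j" "j < l" for j
  proof -
    have "(advance ^^ j) p \<noteq> g p"
      using advance_eq_glue[OF p(1)] closed[OF orbit] by metis
    then have "column p \<noteq> column ((advance ^^ j) p)"
      using same_column[OF closed[OF xp] closed[OF orbit]] l(3)[OF j] by metis
    then show ?thesis
      using y(2)[OF orbit] p(3) by (simp add: order_less_le)
  qed
  then have "cycle_start a p l"
    using p l closed[OF orbit] by (simp add: cycle_start_def)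
  with xp show ?thesis
    by (rule that[rotated])
qed

lemma inj_on_orbit_walk: "inj_on (\<lambda>(p, l). orbit_walk p l) {(p, l). cycle_start a p l}"
proof (rule inj_onI, clarify)
  fix p l p' l'
  assume p: "cycle_start a p l" and eq: "orbit_walk p l = orbit_walk p' l'"
  have "l = l'"
    using arg_cong[OF eq, of length] by simp
  moreover have "sheet p = sheet p' \<and> place p = place p'"
    using arg_cong[OF eq, of "\<lambda>w. w ! 0"] p \<open>l = l'\<close> by (simp add: cycle_start_def)
  ultimately show "p = p' \<and> l = l'"
    using sheet_place_inj by blast
qed

lemma orbit_walk_in_cycle_walks:
  assumes "w = orbit_walk x (length w)" and "length w > 0" "x \<in> X" "fst (place x) = a"
    and "(advance ^^ length w) x = x"
    and joint: "\<And>j. j < length w \<Longrightarrow> g ((advance ^^ j) x) \<noteq> (advance ^^ j) x"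
    and least: "\<And>j. Suc j < length w \<Longrightarrow> column x < snd (tgt w j)"
  shows "w \<in> cycle_walks a"
proof -
  have "column x < column ((advance ^^ j) x)" if "0 < j" "j < length w" for j
  proof -
    obtain i where i: "j = Suc i"
      using \<open>0 < j\<close> by (cases j) auto
    have "g (m ((advance ^^ i) x)) \<noteq> m ((advance ^^ i) x)"
      using joint[OF that(2)] by (simp add: i advance_def)
    then have "column ((advance ^^ j) x) = column (m ((advance ^^ i) x))"
      using place_joint by (simp add: i)
    also have "\<dots> = snd (tgt w i)"
      using arg_cong[OF assms(1), of "\<lambda>v. tgt v i"] that by (simp add: i)
    finally show ?thesis
      using least[of i] that by (simp add: i)
  qed
  then have "cycle_start a x (length w)"
    using assms by (simp add: cycle_start_def)
  then show ?thesis
    using assms(1) unfolding cycle_walks_def by blast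
qed

lemma cycle_start_components:
  assumes "a \<le> 1"
  shows "(\<lambda>(p, l). adj\<^sup>* `` {p}) ` {(p, l). cycle_start a p l} = closed_components"
    (is "?components = _")
proof (intro equalityI subsetI)
  fix C assume "C \<in> ?components"
  then obtain p l where "cycle_start a p l" "C = adj\<^sup>* `` {p}"
    by blast
  then show "C \<in> closed_components"
    using cycle_start_component(2)
    by (auto simp: closed_components_def cycle_start_def intro: quotientI)
next
  fix C assume "C \<in> closed_components"
  then obtain x where x: "x \<in> X" "C = adj\<^sup>* `` {x}" "\<And>y. (x, y) \<in> adj\<^sup>* \<Longrightarrow> g y \<noteq> y"
    by (auto simp: closed_components_def elim: quotientE)
  obtain p l where p: "cycle_start a p l" "(x, p) \<in> adj\<^sup>*"
    using x(1,3) assms by (rule cycle_start_exists)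
  then have "C = adj\<^sup>* `` {p}"
    using adj_sym x(2) by (auto intro: rtrancl_trans)
  with p(1) show "C \<in> ?components"
    by blast
qed

lemma card_cycle_walks:
  assumes "a \<le> 1"
  shows "card (cycle_walks a) = card closed_components"
proof -
  let ?starts = "{(p, l). cycle_start a p l}"
  have "inj_on (\<lambda>(p, l). adj\<^sup>* `` {p}) ?starts"
  proof (rule inj_onI, clarify)
    fix p l p' l'
    assume start: "cycle_start a p l" "cycle_start a p' l'" and "adj\<^sup>* `` {p} = adj\<^sup>* `` {p'}"
    then have "(p, p') \<in> adj\<^sup>*"
      by blast
    with start show "p = p' \<and> l = l'"
      by (rule cycle_start_unique)
  qed
  then have "card ?starts = card closed_components"
    unfolding cycle_start_components[OF assms, symmetric] by (rule card_image[symmetric])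
  moreover have "cycle_walks a = (\<lambda>(p, l). orbit_walk p l) ` ?starts"
    by (auto simp: cycle_walks_def)
  ultimately show ?thesis
    using card_image[OF inj_on_orbit_walk] by metis
qed

end

section \<open>Tangles as matchings\<close>

definition edges_of :: "'a set \<Rightarrow> ('a \<Rightarrow> 'a) \<Rightarrow> 'a set set" where
  "edges_of X m = (\<lambda>x. {x, m x}) ` X"

lemma doubleton_in_edges_of:
  assumes "matching_on X m"
  shows "{x, y} \<in> edges_of X m \<longleftrightarrow> x \<in> X \<and> y = m x"
  using matching_on_invol[OF assms] matching_on_closed[OF assms]
  by (auto simp: edges_of_def doubleton_eq_iff)

lemma
  assumes m: "matching_on X m"
  shows partition_on_edges_of: "partition_on X (edges_of X m)"
    and card_edge: "\<alpha> \<in> edges_of X m \<Longrightarrow> card \<alpha> = 2"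
proof -
  show "partition_on X (edges_of X m)"
  proof (rule partition_onI)
    show "\<Union> (edges_of X m) = X"
      using matching_on_closed[OF m] by (auto simp: edges_of_def)
    fix \<alpha> \<beta> assume "\<alpha> \<in> edges_of X m" "\<beta> \<in> edges_of X m" "\<alpha> \<noteq> \<beta>"
    then show "disjnt \<alpha> \<beta>"
      using matching_on_invol[OF m] matching_on_inj[OF m] by (auto simp: edges_of_def disjnt_def)
  qed (auto simp: edges_of_def)
  show "card \<alpha> = 2" if "\<alpha> \<in> edges_of X m"
    using that matching_on_fixfree[OF m] by (auto simp: edges_of_def card_2_iff)
qed

lemma edges_of_eqI:
  assumes E: "partition_on X E" and edge: "\<And>x. x \<in> X \<Longrightarrow> {x, m x} \<in> E"
  shows "E = edges_of X m"
proof
  show "edges_of X m \<subseteq> E"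
    using edge by (auto simp: edges_of_def)
  show "E \<subseteq> edges_of X m"
  proof
    fix \<alpha> assume \<alpha>: "\<alpha> \<in> E"
    then obtain x where x: "x \<in> \<alpha>" "x \<in> X"
      using partition_onD3[OF E] partition_onD1[OF E] by (metis UnionI ex_in_conv)
    then have "\<alpha> = {x, m x}"
      using partition_onD2[OF E] edge[of x] \<alpha> by (auto dest: disjointD)
    then show "\<alpha> \<in> edges_of X m"
      using x(2) by (auto simp: edges_of_def)
  qed
qed

lemma edges_of_if_partition_on:
  assumes E: "partition_on X E" and pairs: "\<And>\<alpha>. \<alpha> \<in> E \<Longrightarrow> card \<alpha> = 2"
  obtains m where "matching_on X m" "E = edges_of X m"
proof -
  have "\<exists>y. y \<noteq> x \<and> {x, y} \<in> E" if x: "x \<in> X" for x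
  proof -
    obtain \<alpha> where "\<alpha> \<in> E" "x \<in> \<alpha>"
      using partition_onD1[OF E] x by blast
    then show ?thesis
      using pairs[of \<alpha>] unfolding card_2_iff by (metis insert_iff insert_commute singletonD)
  qed
  then obtain mate where mate: "\<And>x. x \<in> X \<Longrightarrow> mate x \<noteq> x \<and> {x, mate x} \<in> E"
    by metis
  define m where "m x = (if x \<in> X then mate x else x)" for x
  have edge: "{x, m x} \<in> E" "m x \<noteq> x" "m x \<in> X" if "x \<in> X" for x
    using mate[OF that] that partition_onD1[OF E] by (auto simp: m_def)
  have "m (m x) = x" for x
  proof (cases "x \<in> X")
    case True
    have "{x, m x} = {m x, m (m x)}"
      using edge(1)[OF True] edge(1)[OF edge(3)[OF True]] partition_onD2[OF E]
      by (auto dest: disjointD)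
    then show ?thesis
      using edge(2)[OF True] by (auto simp: doubleton_eq_iff)
  qed (simp add: m_def)
  then have m: "matching_on X m"
    using edge(2) by (auto simp: matching_on_def m_def)
  show ?thesis
    using m edges_of_eqI[OF E edge(1)] by (rule that)
qed

lemma tangles_eq: "tangles n = {edges_of (pts n) m | m. matching_on (pts n) m}"
  unfolding tangles_def using partition_on_edges_of card_edge edges_of_if_partition_on by blast

lemma pts_cases:
  assumes "p \<in> pts n"
  obtains (zero) k where "p = (0, k)" "k \<in> {1..n}" | (one) k where "p = (1, k)" "k \<in> {1..n}"
  using assms by (cases p) (auto simp: pts_def)

lemma mem_pts_iff: "(a, k) \<in> pts n \<longleftrightarrow> (a = 0 \<or> a = 1) \<and> k \<in> {1..n}"
  by (auto simp: pts_def)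

lemma finite_pts: "finite (pts n)"
  by (simp add: pts_def)

definition flip :: "nat \<Rightarrow> pt \<Rightarrow> pt" where
  "flip n p = (if p \<in> pts n then (1 - fst p, snd p) else p)"

lemma matching_on_flip: "matching_on (pts n) (flip n)"
  by (auto simp: matching_on_def flip_def pts_def)

lemma id_tangle_eq: "id_tangle n = edges_of (pts n) (flip n)"
proof -
  have "id_tangle n = (\<lambda>k. {(0, k), (1, k)}) ` {1..n} \<union> (\<lambda>k. {(1, k), (0, k)}) ` {1..n}"
    by (auto simp: id_tangle_def insert_commute)
  also have "\<dots> = (\<lambda>p. {p, flip n p}) ` (Pair 0 ` {1..n} \<union> Pair 1 ` {1..n})"
    by (auto simp: flip_def pts_def image_Un image_image)
  also have "Pair 0 ` {1..n} \<union> Pair 1 ` {1..n} = pts n"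
    by (auto simp: pts_def)
  finally show ?thesis
    by (simp add: edges_of_def)
qed

section \<open>Gluing canonically labelled tangles\<close>

definition canonical_lift :: "tangle \<Rightarrow> arrow_tangle" where
  "canonical_lift E = (E, restrict canonical_label E)"

fun join_matchings :: "(pt \<Rightarrow> pt) \<Rightarrow> (pt \<Rightarrow> pt) \<Rightarrow> side \<times> pt \<Rightarrow> side \<times> pt" where
  "join_matchings m m' (Lft, p) = (Lft, m p)"
| "join_matchings m m' (Rgt, p) = (Rgt, m' p)"

fun glue :: "nat \<Rightarrow> side \<times> pt \<Rightarrow> side \<times> pt" where
  "glue n (Lft, (a, k)) = (if a = 1 \<and> k \<in> {1..n} then (Rgt, (0, k)) else (Lft, (a, k)))"
| "glue n (Rgt, (a, k)) = (if a = 0 \<and> k \<in> {1..n} then (Lft, (1, k)) else (Rgt, (a, k)))"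

lemma snd_free_end [simp]: "snd (free_end p) = p"
  by (simp add: free_end_def)

lemma glue_free_end: "p \<in> pts n \<Longrightarrow> glue n (free_end p) = free_end p"
  by (cases p) (auto simp: free_end_def pts_def)

lemma side_pt_cases:
  obtains (Lft) a k where "x = (Lft, (a, k))" | (Rgt) a k where "x = (Rgt, (a, k))"
  by (metis prod.exhaust side.exhaust)

locale tangle_pair =
  fixes n :: nat and m m' :: "pt \<Rightarrow> pt"
  assumes left: "matching_on (pts n) m" and right: "matching_on (pts n) m'"
begin

sublocale gluing "UNIV \<times> pts n" "join_matchings m m'" "glue n" fst snd
proof
  show "finite (UNIV \<times> pts n :: (side \<times> pt) set)"
  proof -
    have "finite (UNIV :: side set)"
      by (rule finite_subset[of _ "{Lft, Rgt}"]) (use side.exhaust in auto)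
    then show ?thesis
      using finite_pts by simp
  qed
  have invol: "join_matchings m m' (join_matchings m m' x) = x" for x
    using matching_on_invol[OF left] matching_on_invol[OF right]
    by (cases x rule: side_pt_cases) auto
  have fixfree: "join_matchings m m' x \<noteq> x \<longleftrightarrow> x \<in> UNIV \<times> pts n" for x
    using left right by (cases x rule: side_pt_cases) (auto simp: matching_on_def)
  show "matching_on (UNIV \<times> pts n) (join_matchings m m')"
    using invol fixfree by (simp add: matching_on_def)
  fix x y :: "side \<times> pt"
  show "glue n (glue n x) = x"
    by (cases x rule: side_pt_cases) auto
  show "x \<in> UNIV \<times> pts n" if "glue n x \<noteq> x"
    using that by (cases x rule: side_pt_cases) (auto simp: pts_def split: if_splits)
  show "fst (join_matchings m m' x) = fst x"
    by (cases x rule: side_pt_cases) auto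
  show "x = y" if "fst x = fst y" "snd x = snd y"
    using that by (rule prod_eqI)
  show "fst (snd x) = 0 \<or> fst (snd x) = 1" if "x \<in> UNIV \<times> pts n"
    using that by (auto simp: pts_def)
  show "fst (snd (glue n x)) = 1 - fst (snd x) \<and> snd (snd (glue n x)) = snd (snd x)"
    if "glue n x \<noteq> x"
    using that by (cases x rule: side_pt_cases) (auto split: if_splits)
  show "y = x \<or> y = glue n x"
    if "glue n x \<noteq> x" "glue n y \<noteq> y" "snd (snd x) = snd (snd y)"
    using that by (cases x rule: side_pt_cases; cases y rule: side_pt_cases) (auto split: if_splits)
qed

declare sheet_match [simp]

abbreviation match :: "side \<times> pt \<Rightarrow> side \<times> pt" where
  "match \<equiv> join_matchings m m'"

abbreviation E :: tangle where
  "E \<equiv> edges_of (pts n) m"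

abbreviation E' :: tangle where
  "E' \<equiv> edges_of (pts n) m'"

abbreviation labels :: "side \<Rightarrow> pt set \<Rightarrow> int" where
  "labels \<equiv> join_labels (restrict canonical_label E) (restrict canonical_label E')"

lemma edge_iff: "{p, q} \<in> (case s of Lft \<Rightarrow> E | Rgt \<Rightarrow> E') \<longleftrightarrow>
    p \<in> pts n \<and> match (s, p) = (s, q)"
  using doubleton_in_edges_of[OF left, of p q] doubleton_in_edges_of[OF right, of p q]
  by (cases s) auto

lemma canonically_labelled_labels: "canonically_labelled labels"
  unfolding canonically_labelled_def
proof
  fix x :: "side \<times> pt" assume "x \<in> UNIV \<times> pts n"
  then show "labels (fst x) {snd x, snd (match x)} = canonical_label {snd x, snd (match x)}"
    by (cases x rule: side_pt_cases) (auto simp: join_labels_def edges_of_def)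
qed

lemma glue_adj_eq: "glue_adj n E E' = adj"
proof (rule Set.set_eqI)
  have glue_iff: "x \<noteq> y \<and> y = glue n x \<longleftrightarrow>
      (\<exists>k\<in>{1..n}. x = (Lft, (1, k)) \<and> y = (Rgt, (0, k)) \<or> x = (Rgt, (0, k)) \<and> y = (Lft, (1, k)))"
    for x y :: "side \<times> pt"
    by (cases x rule: side_pt_cases) auto
  have match_iff: "x \<noteq> y \<and> y = match x \<longleftrightarrow>
      (\<exists>p q. x = (Lft, p) \<and> y = (Lft, q) \<and> {p, q} \<in> E \<or> x = (Rgt, p) \<and> y = (Rgt, q) \<and> {p, q} \<in> E')"
    for x y :: "side \<times> pt"
  proof -
    obtain s p where x: "x = (s, p)"
      by (rule prod.exhaust)
    have "p \<in> pts n \<longleftrightarrow> p \<noteq> m p" "p \<in> pts n \<longleftrightarrow> p \<noteq> m' p"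
      using left right unfolding matching_on_def by metis+
    then show ?thesis
      unfolding x doubleton_in_edges_of[OF left] doubleton_in_edges_of[OF right]
      by (cases s) (auto simp del: split_paired_Ex)
  qed
  fix xy :: "(side \<times> pt) \<times> (side \<times> pt)"
  obtain x y where xy: "xy = (x, y)"
    by (rule prod.exhaust)
  have "xy \<in> adj \<longleftrightarrow> x \<noteq> y \<and> y = match x \<or> x \<noteq> y \<and> y = glue n x"
    by (auto simp: adj_def xy)
  then show "xy \<in> glue_adj n E E' \<longleftrightarrow> xy \<in> adj"
    unfolding glue_iff match_iff glue_adj_def xy by blast
qed

lemma free_end_iff: "x \<in> UNIV \<times> pts n \<Longrightarrow> glue n x = x \<longleftrightarrow> x \<in> free_end ` pts n"
  by (cases x rule: side_pt_cases) (auto simp: free_end_def pts_def image_iff split: if_splits)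

lemma glue_loops_eq: "glue_loops n E E' = card closed_components"
proof -
  have "C \<inter> free_end ` pts n = {} \<longleftrightarrow> (\<forall>x\<in>C. glue n x \<noteq> x)" if "C \<in> (UNIV \<times> pts n) // adj\<^sup>*" for C
  proof -
    have "C \<subseteq> UNIV \<times> pts n"
      using that component_in by (auto elim!: quotientE)
    then show ?thesis
      using free_end_iff by blast
  qed
  then show ?thesis
    unfolding glue_loops_def glue_adj_eq closed_components_def by (metis (mono_tags, lifting))
qed

lemma joint_iff: "glue n x \<noteq> x \<longleftrightarrow> snd x \<in> pts n \<and> fst (snd x) = (case fst x of Lft \<Rightarrow> 1 | Rgt \<Rightarrow> 0)"
  by (cases x rule: side_pt_cases) (auto simp: pts_def)

lemma glue_joint:
  "glue n x \<noteq> x \<Longrightarrow>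
    glue n x = (case fst x of Lft \<Rightarrow> (Rgt, (0, column x)) | Rgt \<Rightarrow> (Lft, (1, column x)))"
  by (cases x rule: side_pt_cases) (auto split: if_splits)

lemma advance_joint:
  assumes "glue n (match x) \<noteq> match x"
  shows "fst (snd (match x)) = (case fst x of Lft \<Rightarrow> 1 | Rgt \<Rightarrow> 0)"
    and "advance x =
      (case fst x of Lft \<Rightarrow> (Rgt, (0, column (match x))) | Rgt \<Rightarrow> (Lft, (1, column (match x))))"
  using joint_iff[THEN iffD1, OF assms] glue_joint[OF assms] by (simp_all add: advance_def)

lemma edge_match: "snd x \<in> pts n \<Longrightarrow> {snd x, snd (match x)} \<in> (case fst x of Lft \<Rightarrow> E | Rgt \<Rightarrow> E')"
  unfolding edge_iff by (simp add: prod_eq_iff)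

lemma match_walk:
  assumes "edge w j \<in> (case tag w j of Lft \<Rightarrow> E | Rgt \<Rightarrow> E')" "tag w j = fst y" "src w j = snd y"
  shows "match y = (tag w j, tgt w j)" and "tgt w j \<in> pts n" and "src w j \<in> pts n"
proof -
  show y: "match y = (tag w j, tgt w j)" and "src w j \<in> pts n"
    using assms unfolding edge_iff by simp_all
  then show "tgt w j \<in> pts n"
    using match_in[of y] assms(2,3) by (cases y) simp
qed

lemma walk_is_orbit_walk:
  assumes edge: "\<And>j. j < length w \<Longrightarrow> edge w j \<in> (case tag w j of Lft \<Rightarrow> E | Rgt \<Rightarrow> E')"
    and joint: "\<And>j. Suc j < length w \<Longrightarrow> glue n (tag w j, tgt w j) = (tag w (Suc j), src w (Suc j))"
  defines "x \<equiv> (tag w 0, src w 0)"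
  shows "w = orbit_walk x (length w)"
    and "j < length w \<Longrightarrow> (advance ^^ j) x = (tag w j, src w j)"
    and "j < length w \<Longrightarrow> match ((advance ^^ j) x) = (tag w j, tgt w j)"
proof -
  show orbit: "w = orbit_walk x (length w)"
  proof (rule orbit_walk_eqI)
    fix j y assume y: "j < length w" "tag w j = fst y" "src w j = snd y"
    then show "tgt w j = snd (match y)"
      using match_walk(1)[OF edge] by simp
  next
    fix j y assume y: "Suc j < length w" "tag w j = fst y" "src w j = snd y"
    then have "match y = (tag w j, tgt w j)"
      by (intro match_walk(1)[OF edge]) simp_all
    then show "tag w (Suc j) = fst (advance y) \<and> src w (Suc j) = snd (advance y)"
      using joint[OF y(1)] by (simp add: advance_def)
  qed (simp add: x_def)
  show point: "(advance ^^ j) x = (tag w j, src w j)" if "j < length w" for j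
    using arg_cong[OF orbit, of "\<lambda>v. v ! j"] that by simp
  show "match ((advance ^^ j) x) = (tag w j, tgt w j)" if "j < length w" for j
    using point[OF that] by (intro match_walk(1)[OF edge[OF that]]) simp_all
qed

lemma arc_joint:
  assumes w: "is_arc E E' w" and j: "Suc j < length w"
  shows "glue n (tag w j, tgt w j) \<noteq> (tag w j, tgt w j)"
    and "glue n (tag w j, tgt w j) = (tag w (Suc j), src w (Suc j))"
proof -
  have "edge w j \<in> (case tag w j of Lft \<Rightarrow> E | Rgt \<Rightarrow> E')"
    using w j by (simp add: is_arc_def)
  then have "tgt w j \<in> pts n"
    by (rule match_walk(2)[of _ _ "(tag w j, src w j)"]) simp_all
  moreover have step: "snd (src w (Suc j)) = snd (tgt w j) \<and>
      (tag w j = Lft \<longrightarrow> fst (tgt w j) = 1 \<and> tag w (Suc j) = Rgt \<and> fst (src w (Suc j)) = 0) \<and>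
      (tag w j = Rgt \<longrightarrow> fst (tgt w j) = 0 \<and> tag w (Suc j) = Lft \<and> fst (src w (Suc j)) = 1)"
    using w j unfolding is_arc_def by blast
  ultimately show "glue n (tag w j, tgt w j) \<noteq> (tag w j, tgt w j)"
    unfolding joint_iff by (auto split: side.split)
  then show "glue n (tag w j, tgt w j) = (tag w (Suc j), src w (Suc j))"
    using glue_joint[of "(tag w j, tgt w j)"] step by (auto simp: prod_eq_iff split: side.splits)
qed

lemma label_sum_arc:
  assumes w: "is_arc E E' w"
  shows "label_sum labels w = canonical_label (boundary w)"
proof -
  let ?x = "(tag w 0, src w 0)"
  have edge: "edge w j \<in> (case tag w j of Lft \<Rightarrow> E | Rgt \<Rightarrow> E')" if "j < length w" for j
    using w that unfolding is_arc_def by blast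
  have l: "0 < length w" and less: "pt_less (src w 0) (tgt w (length w - 1))"
    using w by (auto simp: is_arc_def)
  have x: "?x \<in> UNIV \<times> pts n"
    using match_walk(3)[OF edge[OF l], of ?x] by simp
  note orbit = walk_is_orbit_walk[OF edge arc_joint(2)[OF w]]
  have "label_sum labels (orbit_walk ?x (length w)) = (- 1) ^ fst (snd ?x) *
      (int (snd (snd (match ((advance ^^ (length w - 1)) ?x)))) - int (snd (snd ?x)))"
    using arc_joint(1)[OF w]
    by (intro label_sum_orbit_walk x l canonically_labelled_labels) (simp add: orbit(3))
  then show ?thesis
    using l canonical_label_less[OF less] by (simp add: orbit(1)[symmetric] orbit(3) boundary_def)
qed

lemma orbit_walk_is_arc:
  assumes x: "x \<in> UNIV \<times> pts n" "glue n x = x" and exit: "exits_at x k"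
    and less: "pt_less (snd x) (snd (match ((advance ^^ k) x)))"
  shows "is_arc E E' (orbit_walk x (Suc k))"
proof -
  let ?y = "\<lambda>j. (advance ^^ j) x" and ?z = "\<lambda>j. match ((advance ^^ j) x)"
  have pts: "snd (?y j) \<in> pts n" "snd (?z j) \<in> pts n" for j
    using x(1) advance_in[of j x] match_in[of "?y j"] by (simp_all add: mem_Times_iff)
  have free_fst: "fst (snd y) = (case fst y of Lft \<Rightarrow> 0 | Rgt \<Rightarrow> 1)"
    if "glue n y = y" "snd y \<in> pts n" for y
    using that joint_iff[of y] by (auto simp: pts_def split: side.splits)
  have "{snd (?y j), snd (?z j)} \<in> (case fst (?y j) of Lft \<Rightarrow> E | Rgt \<Rightarrow> E')" for j
    using pts(1) by (rule edge_match)
  moreover have "fst (snd (?z j)) = (case fst (?y j) of Lft \<Rightarrow> 1 | Rgt \<Rightarrow> 0) \<and>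
      ?y (Suc j) =
        (case fst (?y j) of Lft \<Rightarrow> (Rgt, (0, column (?z j))) | Rgt \<Rightarrow> (Lft, (1, column (?z j))))"
    if "j < k" for j
    using exit that advance_joint[of "?y j"] by (simp add: exits_at_def)
  moreover have "fst (snd x) = (case fst x of Lft \<Rightarrow> 0 | Rgt \<Rightarrow> 1)"
    using x by (intro free_fst) auto
  moreover have "fst (snd (?z k)) = (case fst (?y k) of Lft \<Rightarrow> 0 | Rgt \<Rightarrow> 1)"
    using exit free_fst[of "?z k"] pts by (simp add: exits_at_def)
  ultimately show ?thesis
    unfolding is_arc_def using less by (auto simp del: funpow.simps upt_Suc split: side.splits)
qed

lemma arc_exists:
  assumes "{p, q} \<in> tangle_star n E E'"
  shows "\<exists>w. is_arc E E' w \<and> boundary w = {p, q}"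
proof -
  obtain a b where ab: "{p, q} = {a, b}" "a \<in> pts n" "b \<in> pts n" "a \<noteq> b"
    "(free_end a, free_end b) \<in> adj\<^sup>*"
    using assms unfolding tangle_star_def glue_adj_eq by blast
  obtain p' q' where p': "p' \<in> pts n" "q' \<in> pts n" "{p', q'} = {p, q}" "pt_less p' q'"
    and conn: "(free_end p', free_end q') \<in> adj\<^sup>*"
  proof (cases "pt_less a b")
    case False
    then show ?thesis
      using that[of b a] ab adj_sym[OF ab(5)] pt_less_total[OF ab(4)] by (simp add: insert_commute)
  qed (use that[of a b] ab in simp)
  have x: "free_end p' \<in> UNIV \<times> pts n" "glue n (free_end p') = free_end p'"
    using p'(1) by (simp_all add: mem_Times_iff glue_free_end)
  obtain k where k: "exits_at (free_end p') k"
    using exits_at_exists[OF x] .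
  have "free_end q' = free_end p' \<or> free_end q' = match ((advance ^^ k) (free_end p'))"
    using free_ends_of_component[OF x(2) k conn glue_free_end[OF p'(2)]] .
  moreover have "q' \<noteq> p'"
    using p'(4) pt_less_asym by blast
  ultimately have q': "snd (match ((advance ^^ k) (free_end p'))) = q'"
    by (metis snd_free_end)
  have "is_arc E E' (orbit_walk (free_end p') (Suc k))"
    using p'(4) by (intro orbit_walk_is_arc x k) (simp add: q')
  moreover have "boundary (orbit_walk (free_end p') (Suc k)) = {p', q'}"
    by (simp add: boundary_def q' del: upt_Suc)
  ultimately show ?thesis
    using p'(3) by blast
qed

lemma arrow_star_canonical_lift:
  "arrow_star n (canonical_lift E) (canonical_lift E') = canonical_lift (tangle_star n E E')"
proof -
  have "(THE k. \<exists>w. is_arc E E' w \<and> boundary w = \<beta> \<and> k = label_sum labels w) = canonical_label \<beta>"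
    if \<beta>: "\<beta> \<in> tangle_star n E E'" for \<beta>
  proof -
    obtain p q where "\<beta> = {p, q}"
      using \<beta> unfolding tangle_star_def by blast
    then obtain w where "is_arc E E' w" "boundary w = \<beta>"
      using arc_exists \<beta> by blast
    then show ?thesis
      using label_sum_arc by (intro the_equality) auto
  qed
  then show ?thesis
    by (simp add: arrow_star_def canonical_lift_def cong: restrict_cong)
qed

lemma cycle_joint:
  assumes w: "is_cycle E E' w" and j: "j < length w"
  shows "edge w j \<in> (case tag w j of Lft \<Rightarrow> E | Rgt \<Rightarrow> E')"
    and "glue n (tag w j, src w j) \<noteq> (tag w j, src w j)"
    and "glue n (tag w j, tgt w j) =
      (if even j then Rgt else Lft, (if even j then 0 else 1, snd (tgt w j)))"
proof -
  have entry: "if even j then tag w j = Lft \<and> edge w j \<in> E \<and> fst (src w j) = 1 \<and> fst (tgt w j) = 1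
      else tag w j = Rgt \<and> edge w j \<in> E' \<and> fst (src w j) = 0 \<and> fst (tgt w j) = 0"
    using w j unfolding is_cycle_def by blast
  then show edge: "edge w j \<in> (case tag w j of Lft \<Rightarrow> E | Rgt \<Rightarrow> E')"
    by (auto split: if_splits)
  have "src w j \<in> pts n" "tgt w j \<in> pts n"
    using match_walk(2,3)[OF edge, of "(tag w j, src w j)"] by simp_all
  with entry have "glue n (tag w j, src w j) \<noteq> (tag w j, src w j)"
    and joint: "glue n (tag w j, tgt w j) \<noteq> (tag w j, tgt w j)"
    unfolding joint_iff by (auto split: if_splits)
  then show "glue n (tag w j, src w j) \<noteq> (tag w j, src w j)"
    by blast
  show "glue n (tag w j, tgt w j) =
      (if even j then Rgt else Lft, (if even j then 0 else 1, snd (tgt w j)))"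
    using glue_joint[OF joint] entry by (auto split: if_splits)
qed

lemma cycle_in_cycle_walks:
  assumes w: "is_cycle E E' w"
  shows "w \<in> cycle_walks 1"
proof -
  let ?x = "(tag w 0, src w 0)" and ?l = "length w"
  have l: "?l > 0" "even ?l"
    using w by (auto simp: is_cycle_def)
  have start: "tag w 0 = Lft" "fst (src w 0) = 1" "snd (src w 0) = snd (tgt w (?l - 1))"
    using w l(1) by (auto simp: is_cycle_def)
  have step: "snd (src w (Suc j)) = snd (tgt w j) \<and> snd (src w 0) < snd (tgt w j)"
    if "Suc j < ?l" for j
    using w that unfolding is_cycle_def by blast
  have side: "tag w j = (if even j then Lft else Rgt) \<and> fst (src w j) = (if even j then 1 else 0)"
    if "j < ?l" for j
    using w that unfolding is_cycle_def by (auto split: if_splits)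
  have "glue n (tag w j, tgt w j) = (tag w (Suc j), src w (Suc j))" if "Suc j < ?l" for j
    using cycle_joint(3)[OF w, of j] side[OF that] step[OF that] that by (simp add: prod_eq_iff)
  note orbit = walk_is_orbit_walk[OF cycle_joint(1)[OF w] this]
  have "(advance ^^ ?l) ?x = glue n (tag w (?l - 1), tgt w (?l - 1))"
    using l(1) orbit(3)[of "?l - 1"] by (cases ?l) (simp_all add: advance_def)
  also have "\<dots> = ?x"
    using cycle_joint(3)[OF w, of "?l - 1"] l start by (simp add: prod_eq_iff)
  finally have closes: "(advance ^^ ?l) ?x = ?x" .
  show ?thesis
  proof (rule orbit_walk_in_cycle_walks[OF _ l(1) _ _ closes])
    show "w = orbit_walk ?x ?l"
      by (rule orbit(1))
    show "?x \<in> UNIV \<times> pts n"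
      using cycle_joint(2)[OF w l(1)] by (rule glue_support)
    show "glue n ((advance ^^ j) ?x) \<noteq> (advance ^^ j) ?x" if "j < ?l" for j
      using cycle_joint(2)[OF w that] orbit(2)[of j] that by simp
  qed (use start step in simp_all)
qed

lemma cycle_start_side:
  assumes p: "cycle_start 1 p l"
  shows "fst ((advance ^^ j) p) = (if even j then Lft else Rgt)"
proof (induction j)
  case 0
  have "fst (snd p) = 1"
    using p by (simp add: cycle_start_def)
  then show ?case
    using cycle_start_joint(1)[OF p, of 0] by (cases p rule: side_pt_cases) auto
next
  case (Suc j)
  then show ?case
    using advance_joint(2)[OF cycle_start_joint(2)[OF p, of j]] by simp
qed

lemma cycle_walk_is_cycle:
  assumes p: "cycle_start 1 p l"
  shows "is_cycle E E' (orbit_walk p l)"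
proof -
  let ?y = "\<lambda>j. (advance ^^ j) p" and ?z = "\<lambda>j. match ((advance ^^ j) p)"
  note side = cycle_start_side[OF p] and joint = joint_iff[THEN iffD1]
  have l: "l > 0" "?y l = p"
    using p by (simp_all add: cycle_start_def)
  have "fst (snd (?y j)) = (if even j then 1 else 0)"
    "fst (snd (?z j)) = (if even j then 1 else 0)" for j
    using joint[OF cycle_start_joint(1)[OF p, of j]] joint[OF cycle_start_joint(2)[OF p, of j]]
      side[of j] by simp_all
  moreover have "even j \<Longrightarrow> {snd (?y j), snd (?z j)} \<in> E"
    "odd j \<Longrightarrow> {snd (?y j), snd (?z j)} \<in> E'" for j
    using edge_match[of "?y j"] joint[OF cycle_start_joint(1)[OF p, of j]] side[of j] by simp_all
  moreover have "even l"
    using side[of l] side[of 0] l(2) by (auto split: if_splits)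
  ultimately show ?thesis
    unfolding is_cycle_def
    using l(1) side cycle_start_step(2)[OF p] cycle_start_closes(2)[OF p] cycle_start_least[OF p]
    by (auto simp del: funpow.simps)
qed

lemma is_cycle_iff: "is_cycle E E' w \<longleftrightarrow> w \<in> cycle_walks 1"
  using cycle_in_cycle_walks cycle_walk_is_cycle unfolding cycle_walks_def by blast

lemma arrow_coeff_canonical_lift:
  "arrow_coeff (canonical_lift E) (canonical_lift E') = za 0 ^ glue_loops n E E'"
proof -
  have "arrow_coeff (canonical_lift E) (canonical_lift E') = (\<Prod>w\<in>cycle_walks 1. za 0)"
    unfolding arrow_coeff_def canonical_lift_def prod.case is_cycle_iff Collect_mem_eq
    by (intro prod.cong)
      (simp_all add: zeta_def label_sum_cycle_walk canonically_labelled_labels del: za.simps)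
  then show ?thesis
    by (simp add: card_cycle_walks glue_loops_eq del: za.simps)
qed

end

lemma arrow_star_canonical_lift:
  assumes "E \<in> tangles n" "E' \<in> tangles n"
  shows "arrow_star n (canonical_lift E) (canonical_lift E') = canonical_lift (tangle_star n E E')"
  using assms tangle_pair.arrow_star_canonical_lift[OF tangle_pair.intro]
  by (auto simp: tangles_eq)

lemma arrow_coeff_canonical_lift:
  assumes "E \<in> tangles n" "E' \<in> tangles n"
  shows "arrow_coeff (canonical_lift E) (canonical_lift E') = za 0 ^ glue_loops n E E'"
  using assms tangle_pair.arrow_coeff_canonical_lift[OF tangle_pair.intro]
  by (auto simp: tangles_eq)

section \<open>Closing canonically labelled tangles\<close>

lemma flip_apply: "p \<in> pts n \<Longrightarrow> fst (flip n p) = 1 - fst p \<and> snd (flip n p) = snd p"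
  by (simp add: flip_def)

locale tangle_closure =
  fixes n :: nat and m :: "pt \<Rightarrow> pt"
  assumes match: "matching_on (pts n) m"
begin

sublocale gluing "pts n" m "flip n" "\<lambda>_. ()" "\<lambda>p. p"
proof
  fix p q
  show "finite (pts n)"
    by (rule finite_pts)
  show "matching_on (pts n) m"
    by (rule match)
  show "flip n (flip n p) = p"
    by (rule matching_on_invol[OF matching_on_flip])
  show in_pts: "p \<in> pts n" if "flip n p \<noteq> p" for p
    using that by (simp add: flip_def split: if_splits)
  show "fst p = 0 \<or> fst p = 1" if "p \<in> pts n"
    using that by (auto simp: pts_def)
  show "fst (flip n p) = 1 - fst p \<and> snd (flip n p) = snd p" if "flip n p \<noteq> p"
    using in_pts[OF that] by (rule flip_apply)
  show "q = p \<or> q = flip n p" if "flip n p \<noteq> p" "flip n q \<noteq> q" "snd p = snd q"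
    using in_pts[OF that(1)] in_pts[OF that(2)] that(3) by (auto simp: pts_def flip_def)
qed simp_all

abbreviation E :: tangle where
  "E \<equiv> edges_of (pts n) m"

lemma closure_adj_eq: "closure_adj n E = adj"
proof -
  have "p \<in> pts n \<longleftrightarrow> p \<noteq> m p" for p
    using match unfolding matching_on_def by metis
  then have "{(p, q). {p, q} \<in> E} = {(p, q). p \<noteq> q \<and> q = m p}"
    unfolding doubleton_in_edges_of[OF match] by blast
  moreover have "{((0, k), (1, k)) | k. k \<in> {1..n}} \<union> {((1, k), (0, k)) | k. k \<in> {1..n}}
      = {(p, q). p \<noteq> q \<and> q = flip n p}" (is "?joints = ?flips")
  proof
    show "?joints \<subseteq> ?flips"
      by (auto simp: flip_def pts_def)
    show "?flips \<subseteq> ?joints"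
    proof
      fix e assume "e \<in> ?flips"
      then obtain p where "p \<noteq> flip n p" and e: "e = (p, flip n p)"
        by blast
      from this(1) have "p \<in> pts n"
        by (rule glue_support[OF not_sym])
      then show "e \<in> ?joints"
        by (cases rule: pts_cases) (simp_all add: e flip_def pts_def)
    qed
  qed
  moreover have "adj = {(p, q). p \<noteq> q \<and> q = m p} \<union> {(p, q). p \<noteq> q \<and> q = flip n p}"
    by (auto simp: adj_def)
  ultimately show ?thesis
    by (simp only: closure_adj_def Un_assoc)
qed

lemma flip_neq: "p \<in> pts n \<Longrightarrow> flip n p \<noteq> p"
  by (rule matching_on_fixfree[OF matching_on_flip])

lemma closure_loops_eq: "closure_loops n E = card closed_components"
proof -
  have "\<forall>p\<in>C. flip n p \<noteq> p" if "C \<in> pts n // adj\<^sup>*" for C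
    using that component_in flip_neq by (auto elim!: quotientE)
  then have "closed_components = pts n // adj\<^sup>*"
    unfolding closed_components_def by blast
  then show ?thesis
    by (simp add: closure_loops_def closure_adj_eq)
qed

lemma closure_cycle_edge:
  assumes w: "is_closure_cycle E w" and j: "j < length w"
  shows "src w j \<in> pts n" "tgt w j = m (src w j)" "tgt w j \<in> pts n"
proof -
  have "edge w j \<in> E"
    using w j unfolding is_closure_cycle_def by blast
  then show "src w j \<in> pts n" "tgt w j = m (src w j)"
    by (simp_all add: doubleton_in_edges_of[OF match])
  then show "tgt w j \<in> pts n"
    by simp
qed

lemma closure_cycle_step:
  assumes w: "is_closure_cycle E w" and j: "Suc j < length w"
  shows "src w (Suc j) = advance (src w j)" and "snd (src w 0) < snd (tgt w j)"
proof -
  have step: "snd (src w (Suc j)) = snd (tgt w j) \<and>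
      (fst (tgt w j) = 0 \<longrightarrow> fst (src w (Suc j)) = 1) \<and>
      (fst (tgt w j) = 1 \<longrightarrow> fst (src w (Suc j)) = 0) \<and> snd (src w 0) < snd (tgt w j)"
    using w j unfolding is_closure_cycle_def by blast
  note edge = closure_cycle_edge[OF w Suc_lessD[OF j]]
  show "src w (Suc j) = advance (src w j)"
    using step flip_apply[OF edge(3)] fst_place[OF edge(3)]
    by (auto simp: advance_def edge(2)[symmetric] prod_eq_iff)
  show "snd (src w 0) < snd (tgt w j)"
    using step by blast
qed

lemma closure_cycle_in_cycle_walks:
  assumes w: "is_closure_cycle E w"
  shows "w \<in> cycle_walks 0"
proof -
  let ?p = "src w 0" and ?l = "length w"
  have "w \<noteq> []" and start: "fst ?p = 0" "fst (tgt w (?l - 1)) = 1" "snd ?p = snd (tgt w (?l - 1))"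
    using w unfolding is_closure_cycle_def by blast+
  then have l: "?l > 0"
    by simp
  note edge = closure_cycle_edge[OF w]
  have orbit: "w = orbit_walk ?p ?l"
    by (rule orbit_walk_eqI) (simp_all add: edge(2) closure_cycle_step(1)[OF w])
  have point: "(advance ^^ j) ?p = src w j" if "j < ?l" for j
    using arg_cong[OF orbit, of "\<lambda>v. v ! j"] that by simp
  have "(advance ^^ ?l) ?p = flip n (tgt w (?l - 1))"
    using l point[of "?l - 1"] edge(2)[of "?l - 1"] by (cases ?l) (simp_all add: advance_def)
  also have "\<dots> = ?p"
    using flip_apply[OF edge(3)[of "?l - 1"]] l start by (simp add: prod_eq_iff)
  finally have closes: "(advance ^^ ?l) ?p = ?p" .
  show ?thesis
    by (rule orbit_walk_in_cycle_walks[OF orbit l edge(1)[OF l] start(1) closes])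
      (simp_all add: point edge(1) flip_neq closure_cycle_step(2)[OF w])
qed

lemma cycle_walk_is_closure_cycle:
  assumes p: "cycle_start 0 p l"
  shows "is_closure_cycle E (orbit_walk p l)"
proof -
  have "(advance ^^ j) p \<in> pts n" and l: "l > 0" and start: "fst p = 0" for j
    using p by (simp_all add: cycle_start_def advance_in)
  then have "{(advance ^^ j) p, m ((advance ^^ j) p)} \<in> E" for j
    by (simp add: doubleton_in_edges_of[OF match])
  with l start show ?thesis
    unfolding is_closure_cycle_def
    using cycle_start_step[OF p] cycle_start_closes[OF p] cycle_start_least[OF p]
    by (auto simp del: funpow.simps)
qed

lemma is_closure_cycle_iff: "is_closure_cycle E w \<longleftrightarrow> w \<in> cycle_walks 0"
  using closure_cycle_in_cycle_walks cycle_walk_is_closure_cycle unfolding cycle_walks_def by blast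

lemma arrow_closure_coeff_canonical_lift:
  "arrow_closure_coeff (canonical_lift E) = za 0 ^ closure_loops n E"
proof -
  have "canonically_labelled (\<lambda>_. restrict canonical_label E)"
    by (simp add: canonically_labelled_def edges_of_def)
  note vanish = label_sum_cycle_walk[OF _ this]
  have "arrow_closure_coeff (canonical_lift E) = (\<Prod>w\<in>cycle_walks 0. za 0)"
    unfolding arrow_closure_coeff_def canonical_lift_def prod.case is_closure_cycle_iff
      Collect_mem_eq
    by (intro prod.cong) (simp_all add: zeta_def vanish del: za.simps)
  then show ?thesis
    by (simp add: card_cycle_walks closure_loops_eq del: za.simps)
qed

end

lemma arrow_closure_coeff_canonical_lift:
  assumes "E \<in> tangles n"
  shows "arrow_closure_coeff (canonical_lift E) = za 0 ^ closure_loops n E"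
  using assms tangle_closure.arrow_closure_coeff_canonical_lift[OF tangle_closure.intro]
  by (auto simp: tangles_eq)

section \<open>Gluing a generator\<close>

abbreviation cap :: "nat \<Rightarrow> (pt \<Rightarrow> pt) \<Rightarrow> pt \<Rightarrow> pt" where
  "cap i \<equiv> reconnect (0, i) (0, Suc i)"

lemma cap_pts:
  assumes "i \<in> {1..<n}"
  shows "(0, i) \<in> pts n" "(0, Suc i) \<in> pts n" "(0 :: nat, i) \<noteq> (0, Suc i)"
  using assms by (auto simp: pts_def)

lemma matching_on_cap: "matching_on (pts n) m \<Longrightarrow> i \<in> {1..<n} \<Longrightarrow> matching_on (pts n) (cap i m)"
  by (simp add: matching_on_reconnect cap_pts)

lemma cap_flip_apply:
  assumes "i \<in> {1..<n}" "(a, k) \<in> pts n"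
  shows "cap i (flip n) (a, k) =
    (if k = i then (a, Suc i) else if k = Suc i then (a, i) else (1 - a, k))"
  using assms by (auto simp: reconnect_def flip_def pts_def transpose_def)

lemma gen_tangle_eq:
  assumes i: "i \<in> {1..<n}"
  shows "gen_tangle n i = edges_of (pts n) (cap i (flip n))"
proof
  note edge_iff = doubleton_in_edges_of[OF matching_on_cap[OF matching_on_flip i]]
  have "{(0, i), (0, Suc i)} \<in> edges_of (pts n) (cap i (flip n))"
    "{(1, i), (1, Suc i)} \<in> edges_of (pts n) (cap i (flip n))"
    "\<And>k. k \<in> {1..n} \<Longrightarrow> k \<noteq> i \<Longrightarrow> k \<noteq> Suc i \<Longrightarrow> {(0, k), (1, k)} \<in> edges_of (pts n) (cap i (flip n))"
    using i by (simp_all add: edge_iff cap_flip_apply mem_pts_iff)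
  then show "gen_tangle n i \<subseteq> edges_of (pts n) (cap i (flip n))"
    by (auto simp: gen_tangle_def)
  show "edges_of (pts n) (cap i (flip n)) \<subseteq> gen_tangle n i"
  proof
    fix \<alpha> assume "\<alpha> \<in> edges_of (pts n) (cap i (flip n))"
    then obtain p where p: "p \<in> pts n" "\<alpha> = {p, cap i (flip n) p}"
      unfolding edges_of_def by blast
    from p(1) show "\<alpha> \<in> gen_tangle n i"
      by (cases rule: pts_cases)
        (use i in \<open>auto simp: p(2) cap_flip_apply mem_pts_iff gen_tangle_def insert_commute\<close>)
  qed
qed

lemma gen_arrow_tangle_eq: "gen_arrow_tangle n i = canonical_lift (gen_tangle n i)"
proof -
  have turn: "canonical_label {(0, i), (0, Suc i)} = 1" "canonical_label {(1, i), (1, Suc i)} = 1"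
    using canonical_label_less[of "(0, i)" "(0, Suc i)"]
      canonical_label_less[of "(1, Suc i)" "(1, i)"]
    by (simp_all add: pt_less_def insert_commute)
  have through: "canonical_label {(0, k), (1, k)} = 0"
    "{(0, k), (1, k)} \<notin> {{(0, i), (0, Suc i)}, {(1, i), (1, Suc i)}}" for k :: nat
    by (auto simp: canonical_label_less pt_less_def doubleton_eq_iff)
  show ?thesis
    unfolding gen_arrow_tangle_def canonical_lift_def
    by (intro arg_cong[of _ _ "Pair _"] restrict_ext)
      (use turn through in \<open>auto simp: gen_tangle_def\<close>)
qed

lemma id_arrow_tangle_eq: "id_arrow_tangle n = canonical_lift (id_tangle n)"
  by (auto simp: id_arrow_tangle_def canonical_lift_def id_tangle_def canonical_label_less
      pt_less_def intro!: restrict_ext)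

locale generator_gluing =
  fixes n i :: nat and m :: "pt \<Rightarrow> pt"
  assumes m: "matching_on (pts n) m" and i: "i \<in> {1..<n}"
begin

sublocale tangle_pair n "cap i (flip n)" m
  using m i by unfold_locales (rule matching_on_cap[OF matching_on_flip])

text \<open>The arc on the side \<open>1\<close> of \<open>E\<^sub>i\<close>, glued to \<open>m\<close>, is the only place for a closed curve.\<close>

definition turnback :: "(side \<times> pt) set" where
  "turnback = {(Lft, (1, i)), (Lft, (1, Suc i)), (Rgt, (0, i)), (Rgt, (0, Suc i))}"

lemma conn_left: "p \<in> pts n \<Longrightarrow> ((Lft, p), (Lft, cap i (flip n) p)) \<in> adj\<^sup>*"
  and conn_right: "((Rgt, p), (Rgt, m p)) \<in> adj\<^sup>*"
  and conn_joint: "k \<in> {1..n} \<Longrightarrow> ((Rgt, (0, k)), (Lft, (1, k))) \<in> adj\<^sup>*"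
  using adj_match[of "(Lft, p)"] adj_match[of "(Rgt, p)"] adj_glue[of "(Rgt, (0, k))"] by simp_all

lemma conn_free_end:
  assumes x: "x \<in> UNIV \<times> pts n" "x \<notin> turnback"
  obtains p where "p \<in> pts n" "(x, free_end p) \<in> adj\<^sup>*" "fst x = Rgt \<Longrightarrow> p = snd x"
proof -
  have through: "((Lft, (1, k)), (Lft, (0, k))) \<in> adj\<^sup>*" if "k \<in> {1..n}" "k \<noteq> i" "k \<noteq> Suc i" for k
    using conn_left[of "(1, k)"] that i by (simp add: cap_flip_apply mem_pts_iff)
  obtain s p where "x = (s, p)" "p \<in> pts n"
    using x(1) by auto
  from this(2) show ?thesis
  proof (cases rule: pts_cases)
    case (zero k)
    have "(x, (Lft, (0, k))) \<in> adj\<^sup>*"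
    proof (cases s)
      case Rgt
      then have "k \<noteq> i" "k \<noteq> Suc i"
        using x(2) \<open>x = (s, p)\<close> zero by (auto simp: turnback_def)
      then show ?thesis
        using rtrancl_trans[OF conn_joint through] zero \<open>x = (s, p)\<close> Rgt by auto
    qed (use zero \<open>x = (s, p)\<close> in simp)
    then show ?thesis
      using that[of "(0, k)"] zero \<open>p \<in> pts n\<close> \<open>x = (s, p)\<close> by (simp add: free_end_def)
  next
    case (one k)
    show ?thesis
    proof (cases s)
      case Lft
      then have "k \<noteq> i" "k \<noteq> Suc i"
        using x(2) \<open>x = (s, p)\<close> one by (auto simp: turnback_def)
      then show ?thesis
        using that[of "(0, k)"] through one \<open>x = (s, p)\<close> Lft by (auto simp: free_end_def pts_def)
    next
      case Rgt
      then show ?thesis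
        using that[of p] one \<open>p \<in> pts n\<close> \<open>x = (s, p)\<close> by (simp add: free_end_def)
    qed
  qed
qed

lemma conn_free_end_right:
  "p \<in> pts n \<Longrightarrow> p \<noteq> (0, i) \<Longrightarrow> p \<noteq> (0, Suc i) \<Longrightarrow> ((Rgt, p), free_end p) \<in> adj\<^sup>*"
  using conn_free_end[of "(Rgt, p)"] by (force simp: turnback_def)

lemma conn_turnback: "x \<in> turnback \<Longrightarrow> ((Rgt, (0, i)), x) \<in> adj\<^sup>*"
proof -
  have "((Lft, (1, i)), (Lft, (1, Suc i))) \<in> adj\<^sup>*"
    using conn_left[of "(1, i)"] i by (simp add: cap_flip_apply mem_pts_iff)
  then have "((Rgt, (0, i)), (Lft, (1, Suc i))) \<in> adj\<^sup>*"
    using conn_joint[of i] i by (auto intro: rtrancl_trans)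
  moreover have "((Lft, (1, Suc i)), (Rgt, (0, Suc i))) \<in> adj\<^sup>*"
    using conn_joint[of "Suc i"] i adj_sym by auto
  ultimately show "x \<in> turnback \<Longrightarrow> ((Rgt, (0, i)), x) \<in> adj\<^sup>*"
    using conn_joint[of i] i by (auto simp: turnback_def intro: rtrancl_trans)
qed

lemma conn_cap_points: "(free_end (0, i), free_end (0, Suc i)) \<in> adj\<^sup>*"
  using conn_left[OF cap_pts(1)[OF i]] i by (simp add: cap_flip_apply mem_pts_iff free_end_def)

lemma conn_cap_mates:
  assumes "m (0, i) \<noteq> (0, Suc i)"
  shows "(free_end (m (0, i)), free_end (m (0, Suc i))) \<in> adj\<^sup>*"
proof -
  let ?a = "(0 :: nat, i)" and ?b = "(0 :: nat, Suc i)"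
  have "m ?b \<noteq> ?a"
    using assms matching_on_invol[OF m] by metis
  have "(free_end (m ?a), (Rgt, m ?a)) \<in> adj\<^sup>*"
    using cap_pts[OF i] assms matching_on_fixfree[OF m] matching_on_closed[OF m]
    by (intro adj_sym[OF conn_free_end_right]) auto
  also have "((Rgt, m ?a), (Rgt, ?a)) \<in> adj\<^sup>*"
    by (rule adj_sym[OF conn_right])
  also have "((Rgt, ?a), (Rgt, ?b)) \<in> adj\<^sup>*"
    by (rule conn_turnback) (simp add: turnback_def)
  also have "((Rgt, ?b), (Rgt, m ?b)) \<in> adj\<^sup>*"
    by (rule conn_right)
  also have "((Rgt, m ?b), free_end (m ?b)) \<in> adj\<^sup>*"
    using cap_pts[OF i] \<open>m ?b \<noteq> ?a\<close> matching_on_fixfree[OF m] matching_on_closed[OF m]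
    by (intro conn_free_end_right) auto
  finally show ?thesis .
qed

lemma conn_cap:
  assumes p: "p \<in> pts n"
  shows "(free_end p, free_end (cap i m p)) \<in> adj\<^sup>*"
proof -
  let ?a = "(0 :: nat, i)" and ?b = "(0 :: nat, Suc i)"
  note ab = cap_pts[OF i]
  from m show ?thesis
  proof (cases rule: reconnect_cases[where x = p and a = ?a and b = ?b])
    case left
    then show ?thesis
      using conn_cap_points reconnect_left[OF m ab] by simp
  next
    case right
    then show ?thesis
      using adj_sym[OF conn_cap_points] reconnect_right[OF m ab] by simp
  next
    case mate_left
    then show ?thesis
      using conn_cap_mates reconnect_mate_left[OF m ab] by simp
  next
    case mate_right
    then show ?thesis
      using adj_sym[OF conn_cap_mates] reconnect_mate_right[OF m ab] by simp
  next
    case other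
    then have "m p \<noteq> ?a" "m p \<noteq> ?b"
      unfolding matching_on_swap[OF m, of p] by auto
    then have "((Rgt, m p), free_end (m p)) \<in> adj\<^sup>*"
      using p matching_on_closed[OF m] by (intro conn_free_end_right) auto
    moreover have "(free_end p, (Rgt, p)) \<in> adj\<^sup>*"
      using p other by (intro adj_sym[OF conn_free_end_right]) auto
    ultimately show ?thesis
      using conn_right[of p] reconnect_other[OF m ab other] by (auto intro: rtrancl_trans)
  qed
qed

lemma tangle_star_cap: "tangle_star n E E' = edges_of (pts n) (cap i m)"
proof -
  note cap = matching_on_cap[OF m i]
  have conn_iff: "(free_end p, free_end q) \<in> adj\<^sup>* \<and> p \<noteq> q \<longleftrightarrow> q = cap i m p"
    if p: "p \<in> pts n" and q: "q \<in> pts n" for p q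
  proof
    assume conn: "(free_end p, free_end q) \<in> adj\<^sup>* \<and> p \<noteq> q"
    have "cap i m p \<in> pts n" "cap i m p \<noteq> p"
      using p matching_on_closed[OF cap] matching_on_fixfree[OF cap p] by simp_all
    then have "free_end q \<noteq> free_end p" "free_end (cap i m p) \<noteq> free_end p"
      using conn by (metis snd_free_end)+
    moreover have "free_end p \<in> UNIV \<times> pts n"
      using p by (simp add: mem_Times_iff)
    ultimately have "free_end q = free_end (cap i m p)"
      using conn conn_cap[OF p] glue_free_end[OF p] glue_free_end[OF q]
        glue_free_end[OF \<open>cap i m p \<in> pts n\<close>]
      by (elim conjE) (rule free_mate_unique[of "free_end p"])
    then show "q = cap i m p"
      by (metis snd_free_end)
  qed (use conn_cap[OF p] matching_on_fixfree[OF cap p] in auto)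
  have edge_iff: "{p, q} \<in> edges_of (pts n) (cap i m) \<longleftrightarrow>
      p \<in> pts n \<and> q \<in> pts n \<and> p \<noteq> q \<and> (free_end p, free_end q) \<in> adj\<^sup>*" for p q
    using conn_iff[of p q] matching_on_closed[OF cap, of p] doubleton_in_edges_of[OF cap, of p q]
    by auto
  show ?thesis
  proof
    show "tangle_star n E E' \<subseteq> edges_of (pts n) (cap i m)"
      using edge_iff by (auto simp: tangle_star_def glue_adj_eq simp del: split_paired_Ex)
    show "edges_of (pts n) (cap i m) \<subseteq> tangle_star n E E'"
    proof
      fix \<alpha> assume \<alpha>: "\<alpha> \<in> edges_of (pts n) (cap i m)"
      then obtain p where "\<alpha> = {p, cap i m p}"
        unfolding edges_of_def by blast
      with \<alpha> show "\<alpha> \<in> tangle_star n E E'"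
        unfolding tangle_star_def glue_adj_eq using edge_iff[of p "cap i m p"] by blast
    qed
  qed
qed

lemma component_turnback:
  assumes joined: "m (0, i) = (0, Suc i)" and "((Rgt, (0, i)), x) \<in> adj\<^sup>*"
  shows "x \<in> turnback"
  using assms(2)
proof (rule component_subset)
  have "m (0, Suc i) = (0, i)"
    using joined matching_on_invol[OF m] by metis
  then show "match z \<in> turnback" if "z \<in> turnback" for z
    using that i joined by (auto simp: turnback_def cap_flip_apply mem_pts_iff)
  show "glue n z \<in> turnback" if "z \<in> turnback" for z
    using that i by (auto simp: turnback_def)
qed (simp add: turnback_def)

lemma closed_component_eq:
  assumes C: "C \<in> closed_components"
  shows "C = adj\<^sup>* `` {(Rgt, (0, i))}"
proof -
  obtain x where x: "x \<in> UNIV \<times> pts n" "C = adj\<^sup>* `` {x}"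
    using C by (auto simp: closed_components_def elim: quotientE)
  have "x \<in> turnback"
    using conn_free_end[OF x(1)] glue_free_end C x(2) unfolding closed_components_def by blast
  then show ?thesis
    using x(2) conn_turnback[of x] adj_sym[OF conn_turnback[of x]] by (auto intro: rtrancl_trans)
qed

lemma turnback_component_closed_iff:
  "adj\<^sup>* `` {(Rgt, (0, i))} \<in> closed_components \<longleftrightarrow> m (0, i) = (0, Suc i)"
proof
  assume closed: "adj\<^sup>* `` {(Rgt, (0, i))} \<in> closed_components"
  have mate: "m (0, i) \<in> pts n"
    using cap_pts[OF i] matching_on_closed[OF m] by auto
  show "m (0, i) = (0, Suc i)"
  proof (rule ccontr)
    assume "m (0, i) \<noteq> (0, Suc i)"
    then have "((Rgt, m (0, i)), free_end (m (0, i))) \<in> adj\<^sup>*"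
      using mate cap_pts[OF i] matching_on_fixfree[OF m] by (intro conn_free_end_right) auto
    then have "((Rgt, (0, i)), free_end (m (0, i))) \<in> adj\<^sup>*"
      using conn_right rtrancl_trans by metis
    then show False
      using closed glue_free_end[OF mate] by (auto simp: closed_components_def)
  qed
next
  assume "m (0, i) = (0, Suc i)"
  then have "glue n x \<noteq> x" if "((Rgt, (0, i)), x) \<in> adj\<^sup>*" for x
    using component_turnback[OF _ that] i by (auto simp: turnback_def)
  then show "adj\<^sup>* `` {(Rgt, (0, i))} \<in> closed_components"
    using cap_pts[OF i] by (auto simp: closed_components_def intro: quotientI)
qed

lemma glue_loops_cap: "glue_loops n E E' = of_bool (m (0, i) = (0, Suc i))"
proof -
  have "closed_components = (if m (0, i) = (0, Suc i) then {adj\<^sup>* `` {(Rgt, (0, i))}} else {})"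
    using closed_component_eq turnback_component_closed_iff by auto
  then show ?thesis
    by (simp add: glue_loops_eq)
qed

end

section \<open>The Temperley--Lieb algebra in the virtual Temperley--Lieb algebra\<close>

definition VTL_gen :: "nat \<Rightarrow> nat \<Rightarrow> (tangle \<Rightarrow>\<^sub>0 Rf)" where
  "VTL_gen n i = Poly_Mapping.single (gen_tangle n i) 1"

abbreviation VTL_word :: "nat \<Rightarrow> nat list \<Rightarrow> (tangle \<Rightarrow>\<^sub>0 Rf) \<Rightarrow> (tangle \<Rightarrow>\<^sub>0 Rf)" where
  "VTL_word n \<equiv> foldr (\<lambda>i y. VTL_gen n i \<otimes>\<^bsub>VTL n\<^esub> y)"

lemma additive_VTL_mult: "additive (\<lambda>y. x \<otimes>\<^bsub>VTL n\<^esub> y)"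
  unfolding VTL_def by (rule additive_basis_algebra_mult_right)

lemma VTL_mult_scale: "x \<otimes>\<^bsub>VTL n\<^esub> scale c y = scale c (x \<otimes>\<^bsub>VTL n\<^esub> y)"
  unfolding VTL_def by (rule basis_algebra_mult_scale)

lemma VTL_gen_mult_single:
  assumes m: "matching_on (pts n) m" and i: "i \<in> {1..<n}"
  shows "VTL_gen n i \<otimes>\<^bsub>VTL n\<^esub> Poly_Mapping.single (edges_of (pts n) m) c =
    Poly_Mapping.single (edges_of (pts n) (cap i m)) (c * zf ^ of_bool (m (0, i) = (0, Suc i)))"
proof -
  interpret generator_gluing n i m
    using assms by unfold_locales
  show ?thesis
    by (simp add: VTL_gen_def VTL_def gen_tangle_eq[OF i] tangle_star_cap glue_loops_cap)
qed

lemma VTL_gen_mult_keys: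
  assumes i: "i \<in> {1..<n}" and y: "Poly_Mapping.keys y \<subseteq> tangles n"
  shows "Poly_Mapping.keys (VTL_gen n i \<otimes>\<^bsub>VTL n\<^esub> y) \<subseteq> tangles n"
  unfolding VTL_def
proof (rule keys_basis_algebra_mult)
  fix E E' assume "E \<in> Poly_Mapping.keys (VTL_gen n i)" "E' \<in> Poly_Mapping.keys y"
  then obtain m where E: "E = gen_tangle n i" "E' = edges_of (pts n) m"
    and m: "matching_on (pts n) m"
    using y by (auto simp: VTL_gen_def tangles_eq)
  interpret generator_gluing n i m
    using m i by unfold_locales
  show "Poly_Mapping.keys (Poly_Mapping.single (tangle_star n E E') (zf ^ glue_loops n E E'))
      \<subseteq> tangles n"
    using matching_on_cap[OF m i] by (auto simp: E gen_tangle_eq[OF i] tangle_star_cap tangles_eq)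
qed

lemma gen_tangle_in_tangles: "i \<in> {1..<n} \<Longrightarrow> gen_tangle n i \<in> tangles n"
  unfolding gen_tangle_eq tangles_eq using matching_on_cap[OF matching_on_flip] by blast

lemma cap_cap:
  assumes "matching_on (pts n) m" "i \<in> {1..<n}"
  shows "cap i m (0, i) = (0, Suc i)" and "cap i (cap i m) = cap i m"
  using reconnect_left[OF assms(1) cap_pts[OF assms(2)]] by (simp_all add: reconnect_of_joined)

lemma cap_commute:
  assumes "matching_on (pts n) m" "i \<in> {1..<n}" "j \<in> {1..<n}" "\<bar>int i - int j\<bar> \<ge> 2"
  shows "cap i (cap j m) = cap j (cap i m)"
    and "of_bool (m (0, j) = (0, Suc j)) + of_bool (cap j m (0, i) = (0, Suc i))
      = (of_bool (m (0, i) = (0, Suc i)) + of_bool (cap i m (0, j) = (0, Suc j)) :: nat)"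
proof -
  have "distinct [(0 :: nat, i), (0, Suc i), (0, j), (0, Suc j)]"
    using assms(4) by auto
  note commute = reconnect_commute[OF assms(1) cap_pts(1,2)[OF assms(2)]
      cap_pts(1,2)[OF assms(3)] this]
  show "cap i (cap j m) = cap j (cap i m)"
    by (rule commute)
  show "of_bool (m (0, j) = (0, Suc j)) + of_bool (cap j m (0, i) = (0, Suc i))
      = (of_bool (m (0, i) = (0, Suc i)) + of_bool (cap i m (0, j) = (0, Suc j)) :: nat)"
    by (rule commute)
qed

lemma cap_braid:
  assumes m: "matching_on (pts n) m" and ij: "i \<in> {1..<n}" "j \<in> {1..<n}" "\<bar>int i - int j\<bar> = 1"
  shows "cap i (cap j (cap i m)) = cap i m"
    and "cap i m (0, j) \<noteq> (0, Suc j)" and "cap j (cap i m) (0, i) \<noteq> (0, Suc i)"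
proof -
  note cap_i = matching_on_cap[OF m ij(1)]
  note cap_ji = matching_on_cap[OF cap_i ij(2)]
  have joined: "cap i m (0, i) = (0, Suc i)" "cap i m (0, Suc i) = (0, i)"
    "cap j (cap i m) (0, j) = (0, Suc j)" "cap j (cap i m) (0, Suc j) = (0, j)"
    using cap_cap(1)[OF m ij(1)] cap_cap(1)[OF cap_i ij(2)]
      matching_on_invol[OF cap_i] matching_on_invol[OF cap_ji] by metis+
  have neighbours: "j = Suc i \<or> i = Suc j"
    using ij(3) by linarith
  then show "cap i (cap j (cap i m)) = cap i m"
    using reconnect_braid[OF m] cap_pts[OF ij(1)] cap_pts[OF ij(2)] by (elim disjE) simp_all
  show "cap i m (0, j) \<noteq> (0, Suc j)"
    using neighbours joined(1,2) matching_on_swap[OF cap_i, of "(0, j)" "(0, i)"] by auto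
  show "cap j (cap i m) (0, i) \<noteq> (0, Suc i)"
    using neighbours joined(3,4) matching_on_swap[OF cap_ji, of "(0, i)" "(0, j)"] by auto
qed

lemma additive_VTL_word: "additive (VTL_word n u)"
proof (induction u)
  case (Cons i u)
  show ?case
    using additive_compose[OF additive_VTL_mult Cons] by (simp add: comp_def)
qed (simp add: additive_def)

lemma VTL_word_relations:
  assumes y: "Poly_Mapping.keys y \<subseteq> tangles n" and i: "i \<in> {1..<n}" and j: "j \<in> {1..<n}"
  shows "VTL_word n [i, i] y = scale zf (VTL_word n [i] y)"
    and "\<bar>int i - int j\<bar> \<ge> 2 \<Longrightarrow> VTL_word n [i, j] y = VTL_word n [j, i] y"
    and "\<bar>int i - int j\<bar> = 1 \<Longrightarrow> VTL_word n [i, j, i] y = VTL_word n [i] y"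
proof -
  note eqI = additive_eqI[OF additive_VTL_word _ y] and mult = VTL_gen_mult_single matching_on_cap
  show "VTL_word n [i, i] y = scale zf (VTL_word n [i] y)"
    by (rule eqI[OF additive_compose[OF additive_scale_right additive_VTL_word]])
      (use i in \<open>auto simp: tangles_eq mult cap_cap mult_ac\<close>)
  show "VTL_word n [i, j] y = VTL_word n [j, i] y" if far: "\<bar>int i - int j\<bar> \<ge> 2"
  proof (rule eqI[OF additive_VTL_word])
    fix E c assume "E \<in> tangles n"
    then obtain m where E: "E = edges_of (pts n) m" and m: "matching_on (pts n) m"
      by (auto simp: tangles_eq)
    show "VTL_word n [i, j] (Poly_Mapping.single E c) = VTL_word n [j, i] (Poly_Mapping.single E c)"
      using m i j by (simp add: E mult mult.assoc power_add[symmetric] cap_commute[OF m i j far])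
  qed
  show "VTL_word n [i, j, i] y = VTL_word n [i] y" if "\<bar>int i - int j\<bar> = 1"
    by (rule eqI[OF additive_VTL_word])
      (use i j that in \<open>auto simp: tangles_eq mult cap_braid\<close>)
qed

interpretation VTL: linear_monoid_action "words {1..<n}" "VTL_word n" "tangles n" for n
proof -
  have scale: "VTL_word n u (scale c y) = scale c (VTL_word n u y)" for u c y
    by (induction u) (simp_all add: VTL_mult_scale)
  have keys: "Poly_Mapping.keys (VTL_word n u y) \<subseteq> tangles n"
    if "u \<in> lists {1..<n}" "Poly_Mapping.keys y \<subseteq> tangles n" for u y
    using that by (induction u) (simp_all add: VTL_gen_mult_keys)
  show "linear_monoid_action (words {1..<n}) (VTL_word n) (tangles n)"
    by (intro linear_monoid_action.intro linear_monoid_action_axioms.intro monoid_words)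
      (use additive_VTL_word scale keys in simp_all)
qed

lemma TL_relators_subset_annihilator: "TL_relators n \<subseteq> VTL.annihilator n"
proof -
  have relator: "Poly_Mapping.single u c - Poly_Mapping.single v d \<in> VTL.annihilator n"
    if "u \<in> lists {1..<n}" "v \<in> lists {1..<n}"
      "\<And>y. Poly_Mapping.keys y \<subseteq> tangles n \<Longrightarrow>
        scale c (VTL_word n u y) = scale d (VTL_word n v y)"
    for u c v d
    using that unfolding VTL.annihilator_def
    by (simp add: keys_diff_subset additive.diff[OF VTL.additive_algebra_action_left])
  show ?thesis
    unfolding TL_relators_def
    by (intro Un_least subsetI; clarify; intro relator)
      (simp_all add: VTL_word_relations del: foldr.simps)
qed

abbreviation eval_VTL :: "nat \<Rightarrow> (nat list \<Rightarrow>\<^sub>0 Rf) \<Rightarrow> (tangle \<Rightarrow>\<^sub>0 Rf)" where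
  "eval_VTL n \<equiv> eval_poly (\<lambda>c. c) (VTL n) (VTL_gen n)"

lemma eval_VTL_eq_action: "eval_VTL n p = VTL.algebra_action n p \<one>\<^bsub>VTL n\<^esub>"
  by (simp add: eval_poly_def VTL.algebra_action_def linext_def)

lemma keys_one_VTL: "Poly_Mapping.keys \<one>\<^bsub>VTL n\<^esub> \<subseteq> tangles n"
  using matching_on_flip by (auto simp: VTL_def id_tangle_eq tangles_eq)

lemma keys_eval_VTL:
  "Poly_Mapping.keys p \<subseteq> lists {1..<n} \<Longrightarrow> Poly_Mapping.keys (eval_VTL n p) \<subseteq> tangles n"
  unfolding eval_VTL_eq_action by (intro VTL.keys_algebra_action keys_one_VTL) simp

lemma TL_representative:
  assumes "x \<in> carrier (TL n)"
  obtains p where "p \<in> x"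
    and "\<And>q. q \<in> x \<Longrightarrow> Poly_Mapping.keys q \<subseteq> lists {1..<n} \<and> eval_VTL n q = eval_VTL n p"
proof -
  let ?A = "free_algebra n"
  let ?I = "genideal ?A (TL_relators n)"
  have carrier: "carrier ?A = {p. Poly_Mapping.keys p \<subseteq> lists {1..<n}}" and add: "add ?A = (+)"
    by (simp_all add: free_algebra_def basis_algebra_def)
  have annihilator: "ideal (VTL.annihilator n) ?A"
    unfolding free_algebra_eq by (rule VTL.ideal_annihilator)
  interpret ring ?A
    unfolding free_algebra_eq by (rule ring_monoid_algebra[OF monoid_words])
  have "?I \<subseteq> VTL.annihilator n"
    using annihilator TL_relators_subset_annihilator by (rule genideal_minimal)
  then have vanish: "eval_VTL n h = 0" if "h \<in> ?I" for h
    using that keys_one_VTL unfolding eval_VTL_eq_action VTL.annihilator_def by blast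
  interpret ideal ?I ?A
    using ideal.Icarr[OF annihilator] TL_relators_subset_annihilator by (intro genideal_ideal) blast
  obtain p where p: "p \<in> carrier ?A" and x: "x = ?I +>\<^bsub>?A\<^esub> p"
    using assms by (auto simp: TL_def FactRing_def A_RCOSETS_def')
  show thesis
  proof
    show "p \<in> x"
      unfolding x using p by (rule a_rcos_self)
    fix q assume "q \<in> x"
    then obtain h where h: "h \<in> ?I" "q = h + p"
      by (auto simp: x a_r_coset_def' add)
    have "Poly_Mapping.keys q \<subseteq> lists {1..<n}"
      using h p carrier keys_add_subset[of h _ p] Icarr[OF h(1)] by simp
    moreover have "eval_VTL n q = eval_VTL n p"
      using vanish[OF h(1)] by (simp add: h(2) eval_VTL_eq_action
          additive.add[OF VTL.additive_algebra_action_left])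
    ultimately show "Poly_Mapping.keys q \<subseteq> lists {1..<n} \<and> eval_VTL n q = eval_VTL n p" ..
  qed
qed

section \<open>The canonical lift to the arrow Temperley--Lieb algebra\<close>

lemma Rf_to_Ra_simps [simp]:
  "Rf_to_Ra 1 = 1" "Rf_to_Ra (c * d) = Rf_to_Ra c * Rf_to_Ra d"
  by (simp_all add: Rf_to_Ra_def mult_single)

lemma Rf_to_Ra_power [simp]: "Rf_to_Ra (c ^ k) = Rf_to_Ra c ^ k"
  by (induction k) simp_all

lemma additive_Rf_to_Ra: "additive Rf_to_Ra"
  by (simp add: additive_def Rf_to_Ra_def single_add)

definition ATL_gen :: "nat \<Rightarrow> nat \<Rightarrow> (arrow_tangle \<Rightarrow>\<^sub>0 Ra)" where
  "ATL_gen n i = Poly_Mapping.single (gen_arrow_tangle n i) 1"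

abbreviation ATL_word :: "nat \<Rightarrow> nat list \<Rightarrow> (arrow_tangle \<Rightarrow>\<^sub>0 Ra) \<Rightarrow> (arrow_tangle \<Rightarrow>\<^sub>0 Ra)" where
  "ATL_word n \<equiv> foldr (\<lambda>i y. ATL_gen n i \<otimes>\<^bsub>ATL n\<^esub> y)"

abbreviation eval_ATL :: "nat \<Rightarrow> (nat list \<Rightarrow>\<^sub>0 Rf) \<Rightarrow> (arrow_tangle \<Rightarrow>\<^sub>0 Ra)" where
  "eval_ATL n \<equiv> eval_poly Rf_to_Ra (ATL n) (ATL_gen n)"

definition VTL_to_ATL :: "(tangle \<Rightarrow>\<^sub>0 Rf) \<Rightarrow> (arrow_tangle \<Rightarrow>\<^sub>0 Ra)" where
  "VTL_to_ATL = linext (\<lambda>E c. Poly_Mapping.single (canonical_lift E) (Rf_to_Ra c))"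

lemma additive_VTL_to_ATL: "additive VTL_to_ATL"
  unfolding VTL_to_ATL_def
  by (intro additive_linext additive_compose[OF additive_single additive_Rf_to_Ra])

lemma VTL_to_ATL_single [simp]:
  "VTL_to_ATL (Poly_Mapping.single E c) = Poly_Mapping.single (canonical_lift E) (Rf_to_Ra c)"
  unfolding VTL_to_ATL_def
  by (rule linext_single[OF additive_compose[OF additive_single additive_Rf_to_Ra]])

lemma VTL_to_ATL_mult:
  assumes x: "Poly_Mapping.keys x \<subseteq> tangles n" and y: "Poly_Mapping.keys y \<subseteq> tangles n"
  shows "VTL_to_ATL (x \<otimes>\<^bsub>VTL n\<^esub> y) = VTL_to_ATL x \<otimes>\<^bsub>ATL n\<^esub> VTL_to_ATL y"
proof -
  note V = additive_VTL_to_ATL and L = additive_basis_algebra_mult_left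
    and R = additive_basis_algebra_mult_right
  have single: "VTL_to_ATL (Poly_Mapping.single E c \<otimes>\<^bsub>VTL n\<^esub> Poly_Mapping.single E' d)
      = VTL_to_ATL (Poly_Mapping.single E c) \<otimes>\<^bsub>ATL n\<^esub> VTL_to_ATL (Poly_Mapping.single E' d)"
    if "E \<in> tangles n" "E' \<in> tangles n" for E E' c d
    using that by (simp add: VTL_def ATL_def arrow_star_canonical_lift arrow_coeff_canonical_lift)
  have "VTL_to_ATL (Poly_Mapping.single E c \<otimes>\<^bsub>VTL n\<^esub> y)
      = VTL_to_ATL (Poly_Mapping.single E c) \<otimes>\<^bsub>ATL n\<^esub> VTL_to_ATL y"
    if "E \<in> tangles n" for E c
    using single[OF that] unfolding VTL_def ATL_def
    by (intro additive_eqI[OF additive_compose[OF V R] additive_compose[OF R V] y])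
  then show ?thesis
    unfolding VTL_def ATL_def
    by (intro additive_eqI[OF additive_compose[OF V L] additive_compose[OF L V] x])
qed

lemma VTL_to_ATL_scale: "VTL_to_ATL (scale c y) = scale (Rf_to_Ra c) (VTL_to_ATL y)"
  by (rule additive_eqI[OF additive_compose[OF additive_VTL_to_ATL additive_scale_right]
        additive_compose[OF additive_scale_right additive_VTL_to_ATL] subset_UNIV]) simp

lemma VTL_to_ATL_gen: "VTL_to_ATL (VTL_gen n i) = ATL_gen n i"
  by (simp add: VTL_gen_def ATL_gen_def gen_arrow_tangle_eq)

lemma VTL_to_ATL_one: "VTL_to_ATL \<one>\<^bsub>VTL n\<^esub> = \<one>\<^bsub>ATL n\<^esub>"
  by (simp add: VTL_def ATL_def id_arrow_tangle_eq)

lemma VTL_to_ATL_word: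
  "u \<in> lists {1..<n} \<Longrightarrow> VTL_to_ATL (VTL_word n u \<one>\<^bsub>VTL n\<^esub>) = ATL_word n u \<one>\<^bsub>ATL n\<^esub>"
proof (induction u rule: lists.induct)
  case (Cons i u)
  have "Poly_Mapping.keys (VTL_gen n i) \<subseteq> tangles n"
    using gen_tangle_in_tangles[OF Cons.hyps(1)] by (simp add: VTL_gen_def)
  moreover have "Poly_Mapping.keys (VTL_word n u \<one>\<^bsub>VTL n\<^esub>) \<subseteq> tangles n"
    using VTL.keys_action[OF _ keys_one_VTL] Cons.hyps(2) by simp
  ultimately show ?case
    using Cons.IH by (simp add: VTL_to_ATL_mult VTL_to_ATL_gen)
qed (simp add: VTL_to_ATL_one)

lemma eval_ATL_eq_VTL_to_ATL:
  assumes "Poly_Mapping.keys p \<subseteq> lists {1..<n}"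
  shows "eval_ATL n p
    = VTL_to_ATL (eval_VTL n p)"
  unfolding eval_poly_def additive.sum[OF additive_VTL_to_ATL]
proof (rule sum.cong)
  fix u assume "u \<in> Poly_Mapping.keys p"
  then have "u \<in> lists {1..<n}"
    using assms by blast
  from VTL_to_ATL_word[OF this]
  show "scale (Rf_to_Ra (Poly_Mapping.lookup p u))
      (ATL_word n u \<one>\<^bsub>ATL n\<^esub>)
    = VTL_to_ATL (scale (Poly_Mapping.lookup p u)
      (VTL_word n u \<one>\<^bsub>VTL n\<^esub>))"
    by (simp add: VTL_to_ATL_scale)
qed simp

lemma trace_a_VTL_to_ATL:
  assumes y: "Poly_Mapping.keys y \<subseteq> tangles n"
  shows "trace_a n (VTL_to_ATL y) = Rf_to_Ra (trace_f n y)"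
proof -
  have trace_a_eq: "trace_a n = linext (\<lambda>F c. c * arrow_closure_coeff F)"
    and trace_f_eq: "trace_f n = linext (\<lambda>E c. c * zf ^ closure_loops n E)"
    by (simp_all add: fun_eq_iff trace_a_def trace_f_def linext_def)
  have additive: "additive (trace_a n)" "additive (trace_f n)"
    unfolding trace_a_eq trace_f_eq by (intro additive_linext additive_mult_right)+
  show ?thesis
  proof (rule additive_eqI[OF additive_compose[OF additive(1) additive_VTL_to_ATL]
        additive_compose[OF additive_Rf_to_Ra additive(2)] y])
    fix E c assume "E \<in> tangles n"
    then show "trace_a n (VTL_to_ATL (Poly_Mapping.single E c))
        = Rf_to_Ra (trace_f n (Poly_Mapping.single E c))"
      by (simp add: trace_a_eq trace_f_eq linext_single additive_mult_right
          arrow_closure_coeff_canonical_lift)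
  qed
qed

lemma
  assumes "x \<in> carrier (TL n)"
  shows iota_eq_VTL_to_ATL: "iota n x = VTL_to_ATL (TL_to_VTL n x)"
    and keys_TL_to_VTL: "Poly_Mapping.keys (TL_to_VTL n x) \<subseteq> tangles n"
proof -
  obtain p where p: "p \<in> x"
    and coset: "\<And>q. q \<in> x \<Longrightarrow> Poly_Mapping.keys q \<subseteq> lists {1..<n} \<and> eval_VTL n q = eval_VTL n p"
    using TL_representative[OF assms] by blast
  have "TL_to_VTL n x = the_elem (eval_VTL n ` x)" "iota n x = the_elem (eval_ATL n ` x)"
    by (simp_all add: TL_to_VTL_def iota_def TL_hom_def VTL_gen_def[abs_def] ATL_gen_def[abs_def])
  moreover have "the_elem (eval_VTL n ` x) = eval_VTL n p"
    by (rule the_elem_image_unique) (use p coset in blast)+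
  moreover have "the_elem (eval_ATL n ` x) = eval_ATL n p"
    by (rule the_elem_image_unique) (use p coset eval_ATL_eq_VTL_to_ATL in \<open>blast, metis\<close>)
  ultimately show "iota n x = VTL_to_ATL (TL_to_VTL n x)"
    and "Poly_Mapping.keys (TL_to_VTL n x) \<subseteq> tangles n"
    using keys_eval_VTL eval_ATL_eq_VTL_to_ATL coset[OF p] by simp_all
qed

theorem proposition3p7:
  fixes n :: nat and x :: "(nat list \<Rightarrow>\<^sub>0 Rf) set"
  assumes "n \<ge> 1" and "x \<in> carrier (TL n)"
  shows "trace_a n (iota n x) = Rf_to_Ra (trace_f n (TL_to_VTL n x))"
proof -
  have "trace_a n (iota n x) = trace_a n (VTL_to_ATL (TL_to_VTL n x))"
    by (simp only: iota_eq_VTL_to_ATL[OF assms(2)])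
  also have "\<dots> = Rf_to_Ra (trace_f n (TL_to_VTL n x))"
    by (rule trace_a_VTL_to_ATL[OF keys_TL_to_VTL[OF assms(2)]])
  finally show ?thesis .
qed

end
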